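(* Let $k\ge 0$, let $B_0\in\mathbb{R}^{n\times n}$ be symmetric, let $(s_0,y_0),\dots,(s_k,y_k)$ be pairs of vectors in $\mathbb{R}^n$ and let $\phi_0,\dots,\phi_k\in\mathbb{R}$. Let $B_1,\dots,B_{k+1}$ be the matrices generated from $B_0$ by the Broyden class updates $$B_{j+1}=B_j-\frac{1}{s_j^TB_js_j}B_js_js_j^TB_j+\frac{1}{y_j^Ts_j}y_jy_j^T+\phi_j(s_j^TB_js_j)w_jw_j^T,\qquad w_j=\frac{y_j}{y_j^Ts_j}-\frac{B_js_j}{s_j^TB_js_j},\qquad 0\le j\le k,$$ where $y_j^Ts_j\neq0$ and $s_j^TB_js_j\ne 0$ for $0\le j\le k$, and $B_0,\dots,B_{k+1}$ are nonsingular. Put $H_0=B_0^{-1}$ and $H_{k+1}=B_{k+1}^{-1}$. With $S_k,Y_k,D_k,R_k,\Pi_k,\Xi_k,\Gamma_k$ as defined in the context, one has $$H_{k+1}=H_0+\widetilde{\Psi}_k\widetilde{M}_k\widetilde{\Psi}_k^T,$$ where $\widetilde{\Psi}_k=(S_k\ \ H_0Y_k)\,\Pi_k^T\Xi_k$ and $$\widetilde{M}_k=\left(-\Xi_k^T\Pi_k\begin{pmatrix}\Gamma_k & D_k+R_k+\Gamma_k\\ D_k+R_k^T+\Gamma_k & D_k+\Gamma_k+Y_k^TH_0Y_k\end{pmatrix}\Pi_k^T\Xi_k\right)^{-1}$$ (the inverse exists).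
   Context: $I_j$ denotes the $j\times j$ identity matrix. $S_k=(s_0\ s_1\ \cdots\ s_k)$ and $Y_k=(y_0\ y_1\ \cdots\ y_k)$, both in $\mathbb{R}^{n\times(k+1)}$. Write $S_k^TY_k=L_k+D_k+R_k$ with $L_k$ strictly lower triangular, $D_k$ diagonal, $R_k$ strictly upper triangular. For each $j$, $\phi_j^{\mathrm{SR1}}=\dfrac{y_j^Ts_j}{y_j^Ts_j-s_j^TB_js_j}$; if $y_j^Ts_j=s_j^TB_js_j$ this value is undefined and $\phi_j\ne\phi_j^{\mathrm{SR1}}$ is regarded as holding. $\Pi_k\in\mathbb{R}^{2(k+1)\times2(k+1)}$ is the permutation matrix $$\Pi_k=\begin{pmatrix} I_k&0&0&0\\0&0&I_k&0\\0&1&0&0\\0&0&0&1\end{pmatrix}\quad(k\ge1),\qquad \Pi_0=I_2,$$ with column blocks of sizes $k,1,k,1$ and row blocks of sizes $k,k,1,1$. $\Xi_k$ is defined recursively by $\Xi_0=E_0$ and $$\Xi_k=\begin{pmatrix}\Pi_{k-1}^T\Xi_{k-1}&0\\0&E_k\end{pmatrix}\quad(k\ge1),\qquad E_j=\begin{cases}(-1\ \ 1)^T\in\mathbb{R}^{2\times1}&\text{if }\phi_j=\phi_j^{\mathrm{SR1}},\\ I_2&\text{otherwise.}\end{cases}$$ $\Gamma_k=\mathrm{diag}(\gamma_0,\dots,\gamma_k)\in\mathbb{R}^{(k+1)\times(k+1)}$ with $$\gamma_j=\begin{cases}\phi_j\left(-\dfrac{1-\phi_j}{s_j^TB_js_j}-\dfrac{\phi_j}{s_j^Ty_j}\right)^{-1}&\text{if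 }\phi_j\neq\phi_j^{\mathrm{SR1}},\\ 0&\text{otherwise.}\end{cases}$$ *)

theory Defs
  imports Complex_Main "Jordan_Normal_Form.Gauss_Jordan_Elimination"
begin

(* Unspecified (the None) if the matrix is singular or not square. *)
definition mat_inv :: "'a :: field mat \<Rightarrow> 'a mat" where
  "mat_inv A = the (mat_inverse A)"

definition outer_prod :: "'a :: semiring_0 vec \<Rightarrow> 'a vec \<Rightarrow> 'a mat" where
  "outer_prod u v = mat (dim_vec u) (dim_vec v) (\<lambda>(i, j). u $ i * v $ j)"

definition diag_part :: "'a :: zero mat \<Rightarrow> 'a mat" where
  "diag_part A = mat (dim_row A) (dim_col A) (\<lambda>(i, j). if i = j then A $$ (i, j) else 0)"

definition strict_upper_part :: "'a :: zero mat \<Rightarrow> 'a mat" where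
  "strict_upper_part A = mat (dim_row A) (dim_col A) (\<lambda>(i, j). if i < j then A $$ (i, j) else 0)"

definition append_cols :: "'a :: zero mat \<Rightarrow> 'a mat \<Rightarrow> 'a mat" where
  "append_cols A B =
     four_block_mat A B (0\<^sub>m 0 (dim_col A)) (0\<^sub>m 0 (dim_col B))"

definition broyden_w :: "real mat \<Rightarrow> real vec \<Rightarrow> real vec \<Rightarrow> real vec" where
  "broyden_w B s y = (1 / (y \<bullet> s)) \<cdot>\<^sub>v y - (1 / (s \<bullet> (B *\<^sub>v s))) \<cdot>\<^sub>v (B *\<^sub>v s)"

definition broyden_update :: "real \<Rightarrow> real vec \<Rightarrow> real vec \<Rightarrow> real mat \<Rightarrow> real mat" where
  "broyden_update \<phi> s y B =
     B - (1 / (s \<bullet> (B *\<^sub>v s))) \<cdot>\<^sub>m (B * outer_prod s s * B)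
       + (1 / (y \<bullet> s)) \<cdot>\<^sub>m outer_prod y y
       + (\<phi> * (s \<bullet> (B *\<^sub>v s))) \<cdot>\<^sub>m outer_prod (broyden_w B s y) (broyden_w B s y)"

fun broyden_seq ::
  "real mat \<Rightarrow> (nat \<Rightarrow> real vec) \<Rightarrow> (nat \<Rightarrow> real vec) \<Rightarrow> (nat \<Rightarrow> real) \<Rightarrow> nat \<Rightarrow> real mat" where
  "broyden_seq B0 s y \<phi> 0 = B0"
| "broyden_seq B0 s y \<phi> (Suc j) =
     broyden_update (\<phi> j) (s j) (y j) (broyden_seq B0 s y \<phi> j)"

(* The SR1 parameter is undefined when y^T s = s^T B s; no parameter equals it then. *)
definition is_SR1 :: "real \<Rightarrow> real vec \<Rightarrow> real vec \<Rightarrow> real mat \<Rightarrow> bool" where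
  "is_SR1 \<phi> s y B \<longleftrightarrow>
     y \<bullet> s \<noteq> s \<bullet> (B *\<^sub>v s) \<and> \<phi> = (y \<bullet> s) / (y \<bullet> s - s \<bullet> (B *\<^sub>v s))"

definition gamma :: "real \<Rightarrow> real vec \<Rightarrow> real vec \<Rightarrow> real mat \<Rightarrow> real" where
  "gamma \<phi> s y B =
     (if \<not> is_SR1 \<phi> s y B
      then \<phi> * inverse (- ((1 - \<phi>) / (s \<bullet> (B *\<^sub>v s))) - \<phi> / (s \<bullet> y))
      else 0)"

(* (v_0 v_1 ... v_k), with n rows *)
definition cols_upto :: "nat \<Rightarrow> nat \<Rightarrow> (nat \<Rightarrow> real vec) \<Rightarrow> real mat" where
  "cols_upto n k v = mat_of_cols n (map v [0..<Suc k])"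

definition Gamma_mat ::
  "real mat \<Rightarrow> (nat \<Rightarrow> real vec) \<Rightarrow> (nat \<Rightarrow> real vec) \<Rightarrow> (nat \<Rightarrow> real) \<Rightarrow> nat \<Rightarrow> real mat" where
  "Gamma_mat B0 s y \<phi> k =
     mat_diag (Suc k) (\<lambda>j. gamma (\<phi> j) (s j) (y j) (broyden_seq B0 s y \<phi> j))"

(* The 4-by-4 block matrix is grouped into 2-by-2 groups of 2-by-2 blocks. *)
definition Pi_mat :: "nat \<Rightarrow> real mat" where
  "Pi_mat k =
     four_block_mat
       (four_block_mat (1\<^sub>m k) (0\<^sub>m k 1)
                       (0\<^sub>m k k) (0\<^sub>m k 1))
       (four_block_mat (0\<^sub>m k k) (0\<^sub>m k 1)
                       (1\<^sub>m k) (0\<^sub>m k 1))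
       (four_block_mat (0\<^sub>m 1 k) (1\<^sub>m 1)
                       (0\<^sub>m 1 k) (0\<^sub>m 1 1))
       (four_block_mat (0\<^sub>m 1 k) (0\<^sub>m 1 1)
                       (0\<^sub>m 1 k) (1\<^sub>m 1))"

lemma Pi_mat_0: "Pi_mat 0 = 1\<^sub>m 2"
  by (rule eq_matI) (auto simp: Pi_mat_def less_2_cases_iff)

definition E_mat :: "real \<Rightarrow> real vec \<Rightarrow> real vec \<Rightarrow> real mat \<Rightarrow> real mat" where
  "E_mat \<phi> s y B = (if is_SR1 \<phi> s y B then mat_of_cols_list 2 [[- 1, 1]] else 1\<^sub>m 2)"

fun Xi_mat ::
  "real mat \<Rightarrow> (nat \<Rightarrow> real vec) \<Rightarrow> (nat \<Rightarrow> real vec) \<Rightarrow> (nat \<Rightarrow> real) \<Rightarrow> nat \<Rightarrow> real mat" where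
  "Xi_mat B0 s y \<phi> 0 = E_mat (\<phi> 0) (s 0) (y 0) B0"
| "Xi_mat B0 s y \<phi> (Suc k) =
     (let P = transpose_mat (Pi_mat k) * Xi_mat B0 s y \<phi> k;
          E = E_mat (\<phi> (Suc k)) (s (Suc k)) (y (Suc k)) (broyden_seq B0 s y \<phi> (Suc k))
      in four_block_mat P (0\<^sub>m (dim_row P) (dim_col E))
                        (0\<^sub>m (dim_row E) (dim_col P)) E)"

end

theory Submission
  imports Defs "Jordan_Normal_Form.Determinant"
begin

text \<open>The formula is built up one update at a time. Write \<open>a = s\<^sup>T B s\<close>,
\<open>b = y\<^sup>T s\<close> and let \<open>E\<close> be the block attached to the update. A Broyden update is a
low-rank correction \<open>B + U M U\<^sup>T\<close> with \<open>U = (B s  y) E\<close>: the natural \<open>2 \<times> 2\<close> middle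
matrix is singular exactly for the SR1 parameter, and then the correction has rank one along
\<open>y - B s = (B s  y) (-1 1)\<^sup>T\<close>. In both cases
\<open>M\<^sup>-\<^sup>1 = E\<^sup>T ((\<gamma> - a  \<gamma>) (\<gamma>  \<gamma> + b)) E\<close> (\<open>broyden_update_rank\<close>). Since
\<open>H U = (s  H y) E\<close> for \<open>H = B\<^sup>-\<^sup>1\<close>, the Woodbury formula \<open>woodbury\<close> gives
\<open>B\<^sub>+\<^sup>-\<^sup>1 = H + V T\<^sup>-\<^sup>1 V\<^sup>T\<close> with \<open>V = (s  H y) E\<close> and
\<open>T = - E\<^sup>T ((\<gamma>  b + \<gamma>) (b + \<gamma>  b + \<gamma> + y\<^sup>T H y)) E\<close>, and invertibility of \<open>T\<close> follows from
that of the updated matrix (\<open>broyden_update_inverse\<close>).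

The vectors \<open>V\<close> involve the current \<open>H\<close>, the compact formula only the initial \<open>H\<^sub>0\<close>.
The two are reconciled by a Schur complement. Suppose \<open>H = H\<^sub>0 + F\<close> with
\<open>F = \<Psi> N\<^sup>-\<^sup>1 \<Psi>\<^sup>T\<close>, and put \<open>Z = (0  y) E\<close>. Passing from \<open>H\<^sub>0\<close> to \<open>H\<close> adds \<open>F Z\<close> to
\<open>(s  H\<^sub>0 y) E\<close> and subtracts \<open>Z\<^sup>T F Z\<close> from \<open>T\<close>. This is precisely what block elimination of \<open>N\<close>
does to the matrix obtained from \<open>N\<close> by bordering it with \<open>- \<Psi>\<^sup>T Z\<close> and the version of \<open>T\<close>
formed with \<open>H\<^sub>0\<close> (\<open>bordered_inverse\<close>).

It remains to see that the matrices of the theorem are bordered in this way when \<open>k\<close> grows by one.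
The permutation moves the new pair of columns \<open>s, H\<^sub>0 y\<close> behind all earlier ones, and in the
permuted kernel the new column belonging to \<open>s\<close> vanishes on the old rows (by triangularity of \<open>R\<close>),
while the one belonging to \<open>y\<close> is \<open>(S  H\<^sub>0 Y)\<^sup>T y\<close> there (\<open>basis_mat_Pi_Suc\<close>,
\<open>Pi_kernel_mat_Pi_Suc\<close>).\<close>

section \<open>Matrix algebra and inverses\<close>

text \<open>Side conditions on dimensions, unlike membership in explicit carriers, contain no variables
that rewriting leaves undetermined; in this form the ring laws can be used by the simplifier.\<close>

lemma mat_assoc:
  "dim_col A = dim_row B \<Longrightarrow> dim_col B = dim_row C \<Longrightarrow> (A * B) * C = A * (B * (C :: 'a :: semiring_0 mat))"
  by (rule assoc_mult_mat[of _ "dim_row A" "dim_row B" _ "dim_row C" _ "dim_col C"]) auto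

lemma mat_distrib:
  fixes A :: "'a :: ring mat"
  shows "dim_row A = dim_row B \<Longrightarrow> dim_col A = dim_col B \<Longrightarrow> dim_col B = dim_row C \<Longrightarrow>
      (A + B) * C = A * C + B * C"
    and "dim_row A = dim_row B \<Longrightarrow> dim_col A = dim_col B \<Longrightarrow> dim_col B = dim_row C \<Longrightarrow>
      (A - B) * C = A * C - B * C"
    and "dim_row B = dim_row C \<Longrightarrow> dim_col B = dim_col C \<Longrightarrow> dim_col A = dim_row C \<Longrightarrow>
      A * (B + C) = A * B + A * C"
    and "dim_row B = dim_row C \<Longrightarrow> dim_col B = dim_col C \<Longrightarrow> dim_col A = dim_row C \<Longrightarrow>
      A * (B - C) = A * B - A * C"
  by (auto intro!: add_mult_distrib_mat minus_mult_distrib_mat mult_add_distrib_mat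
        mult_minus_distrib_mat carrier_matI)

lemma mat_transpose_mult:
  "dim_col A = dim_row B \<Longrightarrow> (A * B)\<^sup>T = B\<^sup>T * (A :: 'a :: comm_semiring_0 mat)\<^sup>T"
  by (rule transpose_mult[of _ "dim_row A" "dim_row B" _ "dim_col B"]) auto

lemmas mat_simps = mat_assoc mat_distrib mat_transpose_mult

text \<open>Cancellation of an inverse inside a product associated to the right.\<close>

lemma mat_cancel:
  fixes A :: "'a :: semiring_1 mat"
  assumes "A * X = 1\<^sub>m r" "dim_col A = dim_row X" "dim_col X = dim_row Z" "dim_row Z = r"
  shows "A * (X * Z) = Z"
  using assms mat_assoc[of A X Z] by simp

lemma mat_eq_diffI:
  fixes A B C :: "'a :: ab_group_add mat"
  assumes "A + B = C" "dim_row A = dim_row B" "dim_col A = dim_col B"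
  shows "B = C - A"
  using assms by (intro eq_matI) auto

lemma mat_eq_addI:
  fixes A B C :: "'a :: ab_group_add mat"
  assumes "A - B = C" "dim_row A = dim_row B" "dim_col A = dim_col B"
  shows "A = C + B"
  using assms by (intro eq_matI) auto

lemma inverse_matI:
  fixes A X :: "'a :: field mat"
  assumes A: "A \<in> carrier_mat n n" and X: "X \<in> carrier_mat n n" and AX: "A * X = 1\<^sub>m n"
  shows "invertible_mat A" and "mat_inv A = X"
proof -
  have XA: "X * A = 1\<^sub>m n" by (rule mat_mult_left_right_inverse[OF A X AX])
  show inv: "invertible_mat A"
    using A X AX XA unfolding invertible_mat_def inverts_mat_def by auto
  have "A \<in> Units (ring_mat TYPE('a) n ())"
    using A X AX XA by (auto simp: Units_def ring_mat_def)
  then obtain Y where Y: "mat_inverse A = Some Y"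
    using mat_inverse(1)[OF A, of "()"] by (cases "mat_inverse A") auto
  with mat_inverse(2)[OF A Y] have "Y * A = 1\<^sub>m n" "Y \<in> carrier_mat n n" by auto
  hence "Y = Y * (A * X)" "(Y * A) * X = X" using AX X by auto
  hence "Y = X" using \<open>Y \<in> _\<close> A X by (simp add: mat_assoc)
  thus "mat_inv A = X" using Y by (simp add: mat_inv_def)
qed

lemma mat_inv_props:
  fixes A :: "'a :: field mat"
  assumes A: "A \<in> carrier_mat n n" and inv: "invertible_mat A"
  shows "mat_inv A \<in> carrier_mat n n" and "A * mat_inv A = 1\<^sub>m n" and "mat_inv A * A = 1\<^sub>m n"
proof -
  from inv A obtain X where X: "A * X = 1\<^sub>m n" "X * A = 1\<^sub>m (dim_row X)"
    unfolding invertible_mat_def inverts_mat_def by auto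
  have "dim_col X = n" using arg_cong[OF X(1), of dim_col] by simp
  moreover have "dim_row X = n" using arg_cong[OF X(2), of dim_col] A by simp
  ultimately have Xc: "X \<in> carrier_mat n n" by auto
  have "mat_inv A = X" by (rule inverse_matI(2)[OF A Xc X(1)])
  thus "mat_inv A \<in> carrier_mat n n" "A * mat_inv A = 1\<^sub>m n" "mat_inv A * A = 1\<^sub>m n"
    using X Xc by auto
qed

lemma transpose_mat_inv:
  fixes A :: "'a :: field mat"
  assumes A: "A \<in> carrier_mat n n" and inv: "invertible_mat A" and sym: "A\<^sup>T = A"
  shows "(mat_inv A)\<^sup>T = mat_inv A"
proof -
  note H = mat_inv_props[OF A inv]
  have "A * (mat_inv A)\<^sup>T = (mat_inv A * A)\<^sup>T"
    using A H(1) sym by (simp add: mat_transpose_mult)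
  also have "\<dots> = 1\<^sub>m n" using H by simp
  finally show ?thesis using inverse_matI(2)[OF A, of "(mat_inv A)\<^sup>T"] H by simp
qed

text \<open>The Woodbury formula. Invertibility of \<open>T\<close> is not an assumption: the formula is symmetric
in \<open>B\<close> and \<open>B + U M V\<close>, so that \<open>M - M V G U M\<close> with \<open>G = (B + U M V)\<^sup>-\<^sup>1\<close> is an
explicit inverse of \<open>T\<close>. Hence a nonsingular update forces a nonsingular middle matrix.\<close>

lemma woodbury:
  fixes B :: "'a :: field mat"
  assumes B: "B \<in> carrier_mat n n" "invertible_mat B"
    and U: "U \<in> carrier_mat n m" and V: "V \<in> carrier_mat m n"
    and M: "M \<in> carrier_mat m m" and C: "C \<in> carrier_mat m m" and CM: "C * M = 1\<^sub>m m"
    and inv: "invertible_mat (B + U * M * V)"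
  defines "H \<equiv> mat_inv B"
  defines "T \<equiv> C + V * H * U"
  shows "invertible_mat T" and "mat_inv (B + U * M * V) = H - H * U * mat_inv T * V * H"
proof -
  define G where "G = mat_inv (B + U * M * V)"
  note H = mat_inv_props[OF B, folded H_def]
  have Bp: "B + U * M * V \<in> carrier_mat n n" using B U M V by auto
  note G = mat_inv_props[OF Bp inv, folded G_def]
  note MC = mat_mult_left_right_inverse[OF C M CM]
  note d = carrier_matD[OF B(1)] carrier_matD[OF U] carrier_matD[OF V] carrier_matD[OF M]
    carrier_matD[OF C] carrier_matD[OF H(1)] carrier_matD[OF G(1)]
  have T: "T \<in> carrier_mat m m" using d by (auto simp: T_def)
  have cHB: "H * (B * Z) = Z" "B * (H * Z) = Z" if "dim_row Z = n" for Z
    using that H d by (auto intro: mat_cancel)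
  have cCM: "C * (M * Z) = Z" "M * (C * Z) = Z" if "dim_row Z = m" for Z
    using that CM MC d by (auto intro: mat_cancel)
  have "(B + U * M * V) * G = B * G + U * (M * (V * G))"
    using d by (simp add: mat_simps)
  hence g: "U * (M * (V * G)) = 1\<^sub>m n - B * G" using G(2) d
    by (intro mat_eq_diffI) simp_all
  have g': "U * (M * (V * (G * Z))) = Z - B * (G * Z)" if "dim_row Z = n" for Z
    using arg_cong[OF g, of "\<lambda>X. X * Z"] d that by (simp add: mat_simps)
  \<comment> \<open>The roles of \<open>B\<close> and \<open>B + U M V\<close> exchanged in the formula to be proved.\<close>
  have "T * (M - M * V * G * U * M) = 1\<^sub>m m"
    using d CM
    by (intro eq_matI) (simp_all del: index_mult_mat(1) add: T_def mat_simps cHB cCM g')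
  note T_inv = inverse_matI[OF T _ this]
  show T': "invertible_mat T" by (rule T_inv) (use d in auto)
  define K where "K = mat_inv T"
  note K = mat_inv_props[OF T T', folded K_def]
  note d = d carrier_matD[OF K(1)]
  have "C * K + V * (H * (U * K)) = 1\<^sub>m m"
    using K(2) d by (simp add: T_def mat_simps)
  hence k: "V * (H * (U * K)) = 1\<^sub>m m - C * K" using d
    by (intro mat_eq_diffI) simp_all
  have k': "V * (H * (U * (K * Z))) = Z - C * (K * Z)" if "dim_row Z = m" for Z
    using arg_cong[OF k, of "\<lambda>X. X * Z"] d that by (simp add: mat_simps)
  have "(B + U * M * V) * (H - H * U * K * V * H) = 1\<^sub>m n"
    using d H
    by (intro eq_matI) (simp_all del: index_mult_mat(1) add: mat_simps cHB cCM k')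
  moreover have "H - H * U * K * V * H \<in> carrier_mat n n"
    using d by (intro carrier_matI) auto
  ultimately show "mat_inv (B + U * M * V) = H - H * U * mat_inv T * V * H"
    unfolding K_def[symmetric] by (intro inverse_matI(2)[OF Bp])
qed

text \<open>Block elimination: \<open>T\<close> is the Schur complement of \<open>N\<close> in the bordered matrix \<open>N'\<close>. The
right-hand side is the old correction \<open>F\<close> plus a new one whose factor \<open>V\<close> has been shifted
by \<open>F Z\<close>. In the application \<open>F\<close> is the accumulated correction of the inverse and \<open>Z = (0  y) E\<close>,
so that the shift replaces \<open>H\<^sub>0 y\<close> by \<open>(H\<^sub>0 + F) y\<close>.\<close>

lemma bordered_inverse:
  fixes N :: "'a :: field mat"
  assumes N: "N \<in> carrier_mat r r" "invertible_mat N"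
    and Psi: "\<Psi> \<in> carrier_mat n r" and Z: "Z \<in> carrier_mat n m" and V: "V \<in> carrier_mat n m"
    and Q: "Q \<in> carrier_mat m m"
  defines "F \<equiv> \<Psi> * mat_inv N * \<Psi>\<^sup>T"
  defines "T \<equiv> Q - Z\<^sup>T * F * Z"
  defines "N' \<equiv> four_block_mat N (- (\<Psi>\<^sup>T * Z)) (- (Z\<^sup>T * \<Psi>)) Q"
  assumes T: "invertible_mat T" and sym: "F\<^sup>T = F"
  shows "invertible_mat N'"
    and "append_cols \<Psi> V * mat_inv N' * (append_cols \<Psi> V)\<^sup>T
      = F + (V + F * Z) * mat_inv T * (V + F * Z)\<^sup>T"
proof -
  define J K where "J = mat_inv N" and "K = mat_inv T"
  note J = mat_inv_props[OF N, folded J_def]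
  note d = carrier_matD[OF N(1)] carrier_matD[OF Psi] carrier_matD[OF Z] carrier_matD[OF V]
    carrier_matD[OF Q] carrier_matD[OF J(1)]
  have Tc: "T \<in> carrier_mat m m" using d by (auto simp: T_def F_def J_def)
  note K = mat_inv_props[OF Tc T, folded K_def]
  note d = d carrier_matD[OF K(1)]
  have cJ: "N * (J * X) = X" "J * (N * X) = X" if "dim_row X = r" for X
    using that J d by (auto intro: mat_cancel)
  have F: "F = \<Psi> * (J * \<Psi>\<^sup>T)" using d by (simp add: F_def J_def[symmetric] mat_simps)
  have FT: "(F * Z)\<^sup>T = Z\<^sup>T * (\<Psi> * (J * \<Psi>\<^sup>T))"
    using d sym F by (simp add: mat_transpose_mult)
  have T_eq: "T = Q - Z\<^sup>T * (\<Psi> * (J * (\<Psi>\<^sup>T * Z)))"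
    unfolding T_def F using d by (simp add: mat_simps)
  have "Q * K - Z\<^sup>T * (\<Psi> * (J * (\<Psi>\<^sup>T * (Z * K)))) = 1\<^sub>m m"
    using K(2) d by (simp add: T_eq mat_simps)
  hence k: "Q * K = 1\<^sub>m m + Z\<^sup>T * (\<Psi> * (J * (\<Psi>\<^sup>T * (Z * K))))" using d
    by (intro mat_eq_addI) simp_all
  have k': "Q * (K * X) = X + Z\<^sup>T * (\<Psi> * (J * (\<Psi>\<^sup>T * (Z * (K * X)))))" if "dim_row X = m" for X
    using arg_cong[OF k, of "\<lambda>Y. Y * X"] d that by (simp add: mat_simps)
  define C where "C = \<Psi>\<^sup>T * Z"
  define C' where "C' = Z\<^sup>T * \<Psi>"
  have dC: "dim_row C = r" "dim_col C = m" "dim_row C' = m" "dim_col C' = r"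
    using d by (auto simp: C_def C'_def)
  \<comment> \<open>The inverse of \<open>N'\<close> given by block elimination.\<close>
  define X where "X = four_block_mat (J + J * C * K * C' * J) (J * C * K) (K * C' * J) K"
  have N'c: "N' \<in> carrier_mat (r + m) (r + m)" unfolding N'_def using d by auto
  have Xc: "X \<in> carrier_mat (r + m) (r + m)" unfolding X_def using d dC by auto
  have k'': "Q * (K * Y) = Y + C' * (J * (C * (K * Y)))" if "dim_row Y = m" for Y
    using k'[OF that] d that by (simp add: C_def C'_def mat_simps)
  have k0: "Q * K = 1\<^sub>m m + C' * (J * (C * K))"
    using k d by (simp add: C_def C'_def mat_simps)
  have b: "N * (J + J * C * K * C' * J) + (- C) * (K * C' * J) = 1\<^sub>m r"
      "N * (J * C * K) + (- C) * K = 0\<^sub>m r m"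
      "(- C') * (J + J * C * K * C' * J) + Q * (K * C' * J) = 0\<^sub>m m r"
      "(- C') * (J * C * K) + Q * K = 1\<^sub>m m"
    using d dC J(2)
    by (auto intro!: eq_matI simp del: index_mult_mat(1) simp: mat_simps cJ k'' k0)
  have "N' * X = four_block_mat (1\<^sub>m r) (0\<^sub>m r m) (0\<^sub>m m r) (1\<^sub>m m)"
    unfolding N'_def X_def C_def[symmetric] C'_def[symmetric]
    by (subst mult_four_block_mat[of _ r r _ m _ m _ _ r _ m])
       (use d dC b in \<open>auto\<close>)
  hence "N' * X = 1\<^sub>m (r + m)" by simp
  note inv = inverse_matI[OF N'c Xc this]
  show "invertible_mat N'" by (rule inv)
  show "append_cols \<Psi> V * mat_inv N' * (append_cols \<Psi> V)\<^sup>T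
      = F + (V + F * Z) * mat_inv T * (V + F * Z)\<^sup>T"
  proof -
    have W: "(append_cols \<Psi> V)\<^sup>T = four_block_mat (\<Psi>\<^sup>T) (0\<^sub>m r 0) (V\<^sup>T) (0\<^sub>m m 0)"
      unfolding append_cols_def
      by (subst transpose_four_block_mat[of _ n r _ m _ 0]) (use d in auto)
    define L1 L2 where "L1 = \<Psi> * (J + J * C * K * C' * J) + V * (K * C' * J)"
      and "L2 = \<Psi> * (J * C * K) + V * K"
    have "append_cols \<Psi> V * X = append_cols L1 L2"
      unfolding append_cols_def X_def L1_def L2_def
      by (subst mult_four_block_mat[of _ n r _ m _ 0 _ _ r _ m]) (use d dC in auto)
    hence "append_cols \<Psi> V * X * (append_cols \<Psi> V)\<^sup>T
        = append_cols L1 L2 * four_block_mat (\<Psi>\<^sup>T) (0\<^sub>m r 0) (V\<^sup>T) (0\<^sub>m m 0)"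
      by (simp add: W)
    also have "\<dots> = four_block_mat (L1 * \<Psi>\<^sup>T + L2 * V\<^sup>T) (0\<^sub>m n 0) (0\<^sub>m 0 n) (0\<^sub>m 0 0)"
      unfolding append_cols_def
      by (subst mult_four_block_mat[of _ n r _ m _ 0 _ _ n _ 0])
         (use d dC in \<open>auto simp: L1_def L2_def intro!: cong_four_block_mat\<close>)
    also have "\<dots> = L1 * \<Psi>\<^sup>T + L2 * V\<^sup>T"
      using d dC by (intro eq_matI) (auto simp: L1_def L2_def simp del: index_mult_mat(1))
    also have "\<dots> = F + (V + F * Z) * K * (V\<^sup>T + Z\<^sup>T * (\<Psi> * (J * \<Psi>\<^sup>T)))"
      using d dC unfolding L1_def L2_def F
      by (intro eq_matI) (simp_all del: index_mult_mat(1) add: mat_simps C_def C'_def)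
    also have "V\<^sup>T + Z\<^sup>T * (\<Psi> * (J * \<Psi>\<^sup>T)) = (V + F * Z)\<^sup>T"
      unfolding FT[symmetric] using d by (intro eq_matI) (auto simp: F simp del: index_mult_mat(1))
    finally show ?thesis unfolding inv(2) K_def .
  qed
qed

section \<open>A single Broyden update\<close>

text \<open>The contribution of a single pair to the kernel of the inverse, with \<open>g = \<gamma>\<close>, \<open>b = y\<^sup>T s\<close>
and \<open>h = y\<^sup>T H y\<close>.\<close>

definition secant_block :: "real \<Rightarrow> real \<Rightarrow> real \<Rightarrow> real mat" where
  "secant_block g b h = mat_of_rows_list 2 [[g, b + g], [b + g, b + g + h]]"

lemma secant_block_carrier: "secant_block g b h \<in> carrier_mat 2 2"
  by (auto simp: secant_block_def mat_of_rows_list_def)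

definition pair_mat :: "real vec \<Rightarrow> real vec \<Rightarrow> real mat" where
  "pair_mat u v = mat (dim_vec u) 2 (\<lambda>(i, j). if j = 0 then u $ i else v $ i)"

lemma pair_mat_carrier: "u \<in> carrier_vec n \<Longrightarrow> pair_mat u v \<in> carrier_mat n 2"
  by (auto simp: pair_mat_def)

lemma mult_pair_mat:
  assumes "A \<in> carrier_mat m n" "u \<in> carrier_vec n" "v \<in> carrier_vec n"
  shows "A * pair_mat u v = pair_mat (A *\<^sub>v u) (A *\<^sub>v v)"
proof -
  have "col (pair_mat u v) 0 = u" "col (pair_mat u v) (Suc 0) = v"
    using assms by (auto simp: pair_mat_def)
  thus ?thesis using assms
    by (intro eq_matI) (auto simp: pair_mat_def less_Suc_eq numeral_2_eq_2)
qed

text \<open>The update as a low-rank correction with an invertible middle matrix. In the basis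
\<open>(B s  y)\<close> the middle matrix has determinant \<open>- d / b\<close> with \<open>d = (1 - \<phi>) / a + \<phi> / b\<close>, and
\<open>d = 0\<close> says exactly that \<open>\<phi>\<close> is the SR1 parameter. Otherwise \<open>\<gamma> = - \<phi> / d\<close>, and \<open>\<gamma>\<close> turns
out to be the off-diagonal entry of the inverse. In the SR1 case \<open>\<gamma> = 0\<close>, and compressing by
\<open>E = (-1 1)\<^sup>T\<close> leaves the scalar \<open>b - a\<close>, the reciprocal of the SR1 coefficient.\<close>

lemma broyden_update_rank:
  fixes B :: "real mat" and s y :: "real vec" and \<phi> :: real
  assumes B: "B \<in> carrier_mat n n" "B\<^sup>T = B" and s: "s \<in> carrier_vec n" and y: "y \<in> carrier_vec n"
    and a0: "s \<bullet> (B *\<^sub>v s) \<noteq> 0" and b0: "y \<bullet> s \<noteq> 0"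
  defines "E \<equiv> E_mat \<phi> s y B" and "a \<equiv> s \<bullet> (B *\<^sub>v s)" and "b \<equiv> y \<bullet> s" and "g \<equiv> gamma \<phi> s y B"
  defines "U \<equiv> pair_mat (B *\<^sub>v s) y * E"
    and "C \<equiv> E\<^sup>T * mat_of_rows_list 2 [[g - a, g], [g, g + b]] * E"
  shows "\<exists>M \<in> carrier_mat (dim_col E) (dim_col E).
    C * M = 1\<^sub>m (dim_col E) \<and> broyden_update \<phi> s y B = B + U * M * U\<^sup>T"
proof -
  define v where "v = B *\<^sub>v s"
  have v: "v \<in> carrier_vec n" using B s by (simp add: v_def)
  have sb: "s \<bullet> y = b" unfolding b_def using s y by (rule comm_scalar_prod)
  have a0: "a \<noteq> 0" and b0: "b \<noteq> 0" using a0 b0 by (auto simp: a_def b_def)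
  \<comment> \<open>\<open>B s s\<^sup>T B = (B s) (B s)\<^sup>T\<close>, by symmetry of \<open>B\<close>.\<close>
  have BB: "(B * outer_prod s s * B) $$ (i, j) = v $ i * v $ j" if "i < n" "j < n" for i j
  proof -
    have "outer_prod s s = mat_of_cols n [s] * (mat_of_cols n [s])\<^sup>T"
      using s by (intro eq_matI) (auto simp: outer_prod_def mat_of_cols_def scalar_prod_def)
    moreover have "B * mat_of_cols n [s] = mat_of_cols n [v]"
      using s B by (intro eq_matI) (auto simp: v_def mat_of_cols_def scalar_prod_def)
    moreover have "(B * mat_of_cols n [s])\<^sup>T = (mat_of_cols n [s])\<^sup>T * B"
      using B by (simp add: mat_transpose_mult del: transpose_mat_eq)
    ultimately have o: "outer_prod s s = mat_of_cols n [s] * (mat_of_cols n [s])\<^sup>T"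
      and Bs: "B * mat_of_cols n [s] = mat_of_cols n [v]"
      and sB: "(mat_of_cols n [s])\<^sup>T * B = (mat_of_cols n [v])\<^sup>T" using B(2) by auto
    have "B * outer_prod s s * B = (B * mat_of_cols n [s]) * ((mat_of_cols n [s])\<^sup>T * B)"
      unfolding o using B(1) by (simp add: mat_assoc)
    hence "B * outer_prod s s * B = mat_of_cols n [v] * (mat_of_cols n [v])\<^sup>T"
      unfolding Bs sB .
    thus ?thesis using that by (simp add: scalar_prod_def mat_of_cols_def)
  qed
  have av: "s \<bullet> v = a" by (simp add: a_def v_def)
  define w where "w = broyden_w B s y"
  have w: "w $ i = y $ i / b - v $ i / a" "dim_vec w = n" if "i < n" for i
    using that v y by (simp_all add: w_def broyden_w_def v_def[symmetric] av b_def[symmetric])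
  have upd_eq: "broyden_update \<phi> s y B = B - (1 / a) \<cdot>\<^sub>m (B * outer_prod s s * B)
      + (1 / b) \<cdot>\<^sub>m outer_prod y y + (\<phi> * a) \<cdot>\<^sub>m outer_prod w w"
    by (simp add: broyden_update_def v_def[symmetric] av b_def[symmetric] w_def[symmetric])
  have wd: "w \<in> carrier_vec n" using v y by (simp add: w_def broyden_w_def v_def[symmetric])
  have upd_dim: "broyden_update \<phi> s y B \<in> carrier_mat n n"
    using B(1) wd by (intro carrier_matI) (simp_all add: upd_eq outer_prod_def)
  have upd: "broyden_update \<phi> s y B $$ (i, j) = B $$ (i, j) - v $ i * v $ j / a + y $ i * y $ j / b
      + \<phi> * a * ((y $ i / b - v $ i / a) * (y $ j / b - v $ j / a))" if ij: "i < n" "j < n" for i j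
  proof -
    have "broyden_update \<phi> s y B $$ (i, j) = B $$ (i, j) - (1 / a) * (v $ i * v $ j)
      + (1 / b) * (y $ i * y $ j) + \<phi> * a * (w $ i * w $ j)"
      unfolding upd_eq BB[OF ij, symmetric]
      using ij carrier_matD[OF B(1)] carrier_vecD[OF y] carrier_vecD[OF wd]
      by (simp add: outer_prod_def del: index_mult_mat(1))
    thus ?thesis using ij by (simp add: w)
  qed
  have two: "{0..<2::nat} = {0, 1}" by auto
  show ?thesis
  proof (cases "is_SR1 \<phi> s y B")
    case True
    hence ba: "b - a \<noteq> 0" and \<phi>: "\<phi> = b / (b - a)" by (auto simp: is_SR1_def a_def b_def)
    have g: "g = 0" using True by (simp add: g_def gamma_def)
    have E: "E = mat_of_cols_list 2 [[- 1, 1]]" using True by (simp add: E_def E_mat_def)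
    have dE: "dim_row E = 2" "dim_col E = 1" by (auto simp: E mat_of_cols_list_def)
    have eE: "E $$ (0, 0) = - 1" "E $$ (Suc 0, 0) = 1" by (auto simp: E mat_of_cols_list_def)
    define M where "M = mat 1 1 (\<lambda>_. 1 / (b - a))"
    have "C * M = 1\<^sub>m (dim_col E)" using ba
      by (intro eq_matI) (auto simp: C_def M_def dE eE g scalar_prod_def two mat_of_rows_list_def field_simps)
    moreover have "broyden_update \<phi> s y B = B + U * M * U\<^sup>T"
    proof (rule eq_matI)
      fix i j assume "i < dim_row (B + U * M * U\<^sup>T)" "j < dim_col (B + U * M * U\<^sup>T)"
      hence ij: "i < n" "j < n" using v by (auto simp: U_def pair_mat_def v_def[symmetric])
      have "(U * M * U\<^sup>T) $$ (i, j) = (y $ i - v $ i) * (y $ j - v $ j) / (b - a)"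
        using ij v y by (simp add: U_def M_def dE eE pair_mat_def v_def[symmetric] scalar_prod_def two)
      also have "\<dots> = - v $ i * v $ j / a + y $ i * y $ j / b
          + \<phi> * a * ((y $ i / b - v $ i / a) * (y $ j / b - v $ j / a))"
        unfolding \<phi> using a0 b0 ba by (simp add: divide_simps) (simp add: algebra_simps)
      finally show "broyden_update \<phi> s y B $$ (i, j) = (B + U * M * U\<^sup>T) $$ (i, j)"
        using upd[OF ij] ij v by (simp add: U_def pair_mat_def v_def[symmetric] del: index_mult_mat(1))
    qed (use upd_dim v in \<open>auto simp: U_def pair_mat_def v_def[symmetric]\<close>)
    ultimately show ?thesis by (intro bexI[of _ M]) (auto simp: M_def dE)
  next
    case False
    define d where "d = (1 - \<phi>) / a + \<phi> / b"
    have d0: "d \<noteq> 0"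
    proof
      assume "d = 0"
      hence eq: "\<phi> * (b - a) = b" using a0 b0 by (simp add: d_def field_simps)
      with b0 have "b \<noteq> a" by auto
      moreover from this eq have "\<phi> = b / (b - a)" by (simp add: eq_divide_eq)
      ultimately show False using False by (simp add: is_SR1_def a_def[symmetric] b_def[symmetric])
    qed
    have "g = \<phi> * inverse (- ((1 - \<phi>) / a) - \<phi> / b)"
      using False by (simp add: g_def gamma_def a_def[symmetric] sb)
    also have "- ((1 - \<phi>) / a) - \<phi> / b = - d" by (simp add: d_def)
    finally have g: "g = - \<phi> / d" by (simp add: field_class.field_divide_inverse)
    have E: "E = 1\<^sub>m 2" using False by (simp add: E_def E_mat_def)
    \<comment> \<open>The coefficients of \<open>(B s) (B s)\<^sup>T\<close>, of the mixed terms and of \<open>y y\<^sup>T\<close> in the update.\<close>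
    define p q r where "p = - (1 - \<phi>) / a" and "q = - \<phi> / b" and "r = (1 + \<phi> * a / b) / b"
    define M where "M = mat_of_rows_list 2 [[p, q], [q, r]]"
    have M: "M \<in> carrier_mat 2 2" by (auto simp: M_def mat_of_rows_list_def)
    define C' where "C' = mat_of_rows_list 2 [[g - a, g], [g, g + b]]"
    have C'c: "C' \<in> carrier_mat 2 2" by (auto simp: C'_def mat_of_rows_list_def)
    have C: "C = C'" using C'c unfolding C_def C'_def[symmetric] E by simp
    have U: "U = pair_mat v y" unfolding U_def E v_def[symmetric]
      by (rule right_mult_one_mat[of _ n]) (use v in \<open>auto intro: pair_mat_carrier\<close>)
    have gd: "g * d = - \<phi>" using d0 by (simp add: g)
    have "(g - a) * p + g * q = 1 - \<phi> - g * d" "(g - a) * q + g * r = (g * d + \<phi>) * a / b"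
      "g * p + (g + b) * q = - g * d - \<phi>" "g * q + (g + b) * r = (g * d + \<phi>) * a / b + 1"
      using a0 b0 by (simp_all add: d_def p_def q_def r_def field_simps)
    hence e: "(g - a) * p + g * q = 1" "(g - a) * q + g * r = 0"
      "g * p + (g + b) * q = 0" "g * q + (g + b) * r = 1" by (simp_all add: gd)
    have "C' * M = 1\<^sub>m 2"
    proof (rule eq_matI)
      fix i j assume "i < dim_row (1\<^sub>m 2 :: real mat)" "j < dim_col (1\<^sub>m 2 :: real mat)"
      hence "i = 0 \<or> i = 1" "j = 0 \<or> j = 1" by auto
      thus "(C' * M) $$ (i, j) = 1\<^sub>m 2 $$ (i, j)"
        by (elim disjE) (simp_all add: C'_def M_def scalar_prod_def two mat_of_rows_list_def e)
    qed (use C'c M in auto)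
    hence "C * M = 1\<^sub>m (dim_col E)" by (simp add: C E)
    moreover have "broyden_update \<phi> s y B = B + U * M * U\<^sup>T"
    proof (rule eq_matI)
      fix i j assume "i < dim_row (B + U * M * U\<^sup>T)" "j < dim_col (B + U * M * U\<^sup>T)"
      hence ij: "i < n" "j < n" using v by (auto simp: U pair_mat_def)
      have "(U * M * U\<^sup>T) $$ (i, j) = (v $ i * p + y $ i * q) * v $ j + (v $ i * q + y $ i * r) * y $ j"
        using ij v y by (simp add: U M_def mat_of_rows_list_def pair_mat_def scalar_prod_def two)
      also have "\<dots> = - v $ i * v $ j / a + y $ i * y $ j / b
          + \<phi> * a * ((y $ i / b - v $ i / a) * (y $ j / b - v $ j / a))"
        using a0 b0 by (simp add: p_def q_def r_def divide_simps) (simp add: algebra_simps)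
      finally show "broyden_update \<phi> s y B $$ (i, j) = (B + U * M * U\<^sup>T) $$ (i, j)"
        using upd[OF ij] ij v by (simp add: U pair_mat_def del: index_mult_mat(1))
    qed (use upd_dim v in \<open>auto simp: U pair_mat_def\<close>)
    ultimately show ?thesis using M by (intro bexI[of _ M]) (auto simp: E)
  qed
qed


lemma quadratic_pair_mat:
  assumes H: "H \<in> carrier_mat n n" "H\<^sup>T = H" and u: "u \<in> carrier_vec n" and v: "v \<in> carrier_vec n"
  shows "(pair_mat u v)\<^sup>T * H * pair_mat u v
    = mat_of_rows_list 2 [[u \<bullet> (H *\<^sub>v u), u \<bullet> (H *\<^sub>v v)], [u \<bullet> (H *\<^sub>v v), v \<bullet> (H *\<^sub>v v)]]"
proof -
  have row: "row (pair_mat u v)\<^sup>T 0 = u" "row (pair_mat u v)\<^sup>T 1 = v"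
    and col: "col (pair_mat u v) 0 = u" "col (pair_mat u v) 1 = v"
    using u v by (auto simp: pair_mat_def)
  have "v \<bullet> (H *\<^sub>v u) = (H *\<^sub>v v) \<bullet> u"
    using transpose_vec_mult_scalar[OF H(1) u v] H(2) by simp
  also have "\<dots> = u \<bullet> (H *\<^sub>v v)" using H u v by (intro comm_scalar_prod[of _ n]) auto
  finally have vu: "v \<bullet> (H *\<^sub>v u) = u \<bullet> (H *\<^sub>v v)" .
  have eq: "(pair_mat u v)\<^sup>T * H * pair_mat u v = (pair_mat u v)\<^sup>T * (H * pair_mat u v)"
    using H u by (intro mat_assoc) (auto simp: pair_mat_def)
  have col': "col (H * pair_mat u v) 0 = H *\<^sub>v u" "col (H * pair_mat u v) 1 = H *\<^sub>v v"
    using col H u by (auto simp: pair_mat_def intro!: eq_vecI)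
  show ?thesis unfolding eq
  proof (rule eq_matI, goal_cases)
    case (1 i j)
    hence "i = 0 \<or> i = 1" "j = 0 \<or> j = 1" by (auto simp: mat_of_rows_list_def)
    thus ?case
      by (elim disjE) (use row col' vu in \<open>simp_all add: mat_of_rows_list_def, simp_all add: pair_mat_def\<close>)
  qed (auto simp: pair_mat_def mat_of_rows_list_def)
qed

text \<open>One step of the compact representation, relative to the current inverse \<open>H\<close>: this is
\<open>woodbury\<close> for the correction of \<open>broyden_update_rank\<close>, using \<open>H (B s) = s\<close>. The entries of
\<open>(B s  y)\<^sup>T H (B s  y)\<close> are \<open>a\<close>, \<open>b\<close> and \<open>y\<^sup>T H y\<close>; the first cancels against \<open>\<gamma> - a\<close>.\<close>

lemma broyden_update_inverse:
  fixes B :: "real mat" and s y :: "real vec" and \<phi> :: real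
  assumes B: "B \<in> carrier_mat n n" "B\<^sup>T = B" and s: "s \<in> carrier_vec n" and y: "y \<in> carrier_vec n"
    and a0: "s \<bullet> (B *\<^sub>v s) \<noteq> 0" and b0: "y \<bullet> s \<noteq> 0"
    and inv: "invertible_mat B" "invertible_mat (broyden_update \<phi> s y B)"
  defines "E \<equiv> E_mat \<phi> s y B" and "H \<equiv> mat_inv B"
  defines "T \<equiv> - (E\<^sup>T * secant_block (gamma \<phi> s y B) (y \<bullet> s) (y \<bullet> (H *\<^sub>v y)) * E)"
    and "V \<equiv> pair_mat s (H *\<^sub>v y) * E"
  shows "invertible_mat T"
    and "mat_inv (broyden_update \<phi> s y B) = H + V * mat_inv T * V\<^sup>T"
proof -
  define g a b U m where "g = gamma \<phi> s y B" and "a = s \<bullet> (B *\<^sub>v s)" and "b = y \<bullet> s"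
    and "U = pair_mat (B *\<^sub>v s) y * E" and "m = dim_col E"
  define C where "C = E\<^sup>T * mat_of_rows_list 2 [[g - a, g], [g, g + b]] * E"
  define h where "h = y \<bullet> (H *\<^sub>v y)"
  have E: "E \<in> carrier_mat 2 m" by (auto simp: E_def E_mat_def m_def mat_of_cols_list_def)
  obtain M where M: "M \<in> carrier_mat m m" "C * M = 1\<^sub>m m"
      and upd: "broyden_update \<phi> s y B = B + U * M * U\<^sup>T"
    using broyden_update_rank[OF B s y a0 b0, of \<phi>]
    unfolding E_def C_def g_def a_def b_def U_def m_def by blast
  note H = mat_inv_props[OF B(1) inv(1), folded H_def]
  have HT: "H\<^sup>T = H" unfolding H_def by (rule transpose_mat_inv[OF B(1) inv(1) B(2)])
  have Bs: "B *\<^sub>v s \<in> carrier_vec n" using B s by auto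
  have HBs: "H *\<^sub>v (B *\<^sub>v s) = s"
    using H B s by (simp add: assoc_mult_mat_vec[of _ n n _ n, symmetric])
  have P: "pair_mat (B *\<^sub>v s) y \<in> carrier_mat n 2" by (rule pair_mat_carrier[OF Bs])
  have U: "U \<in> carrier_mat n m" using P E unfolding U_def by auto
  have Cc: "C \<in> carrier_mat m m" using E by (auto simp: C_def mat_of_rows_list_def)
  have HU: "H * U = V"
  proof -
    have "H * pair_mat (B *\<^sub>v s) y = pair_mat (H *\<^sub>v (B *\<^sub>v s)) (H *\<^sub>v y)"
      by (rule mult_pair_mat[OF H(1) Bs y])
    hence "H * pair_mat (B *\<^sub>v s) y * E = V" by (simp add: V_def HBs)
    thus ?thesis using carrier_matD[OF H(1)] carrier_matD[OF P] carrier_matD[OF E]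
      by (simp add: U_def mat_assoc)
  qed
  have V: "V \<in> carrier_mat n m" using HU H(1) U by auto
  have UH: "U\<^sup>T * H = V\<^sup>T" using arg_cong[OF HU, of transpose_mat] H(1) U HT
    by (simp add: mat_transpose_mult)
  have ys: "(B *\<^sub>v s) \<bullet> (H *\<^sub>v y) = b"
  proof -
    have "(B *\<^sub>v s) \<bullet> (H *\<^sub>v y) = s \<bullet> (B *\<^sub>v (H *\<^sub>v y))"
      using transpose_vec_mult_scalar[OF B(1), of "H *\<^sub>v y" s] B H(1) s y by simp
    also have "B *\<^sub>v (H *\<^sub>v y) = y"
      using H B y by (simp add: assoc_mult_mat_vec[of _ n n _ n, symmetric])
    also have "s \<bullet> y = b" unfolding b_def using s y by (rule comm_scalar_prod)
    finally show ?thesis .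
  qed
  have as: "(B *\<^sub>v s) \<bullet> s = a" unfolding a_def using Bs s by (rule comm_scalar_prod)
  have T: "C + U\<^sup>T * H * U = - T"
  proof -
    define L where "L = mat_of_rows_list 2 [[g - a, g], [g, g + b]]"
    define W where "W = (pair_mat (B *\<^sub>v s) y)\<^sup>T * H * pair_mat (B *\<^sub>v s) y"
    have L: "L \<in> carrier_mat 2 2" by (auto simp: L_def mat_of_rows_list_def)
    have Wc: "W \<in> carrier_mat 2 2" using P by (auto simp: W_def)
    have "W = mat_of_rows_list 2 [[a, b], [b, h]]"
      unfolding W_def using quadratic_pair_mat[OF H(1) HT Bs y] by (simp add: HBs as ys h_def)
    hence LW: "L + W = secant_block g b h"
      unfolding L_def secant_block_def
      by (intro eq_matI) (auto simp: mat_of_rows_list_def less_Suc_eq numeral_2_eq_2)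
    have "U\<^sup>T * H * U = E\<^sup>T * W * E"
      using carrier_matD[OF E] carrier_matD[OF H(1)] carrier_matD[OF P]
      unfolding U_def W_def by (simp add: mat_simps)
    hence "C + U\<^sup>T * H * U = E\<^sup>T * (L + W) * E"
      using carrier_matD[OF E] carrier_matD[OF L] carrier_matD[OF Wc]
      unfolding C_def L_def[symmetric] by (simp add: mat_simps)
    thus ?thesis unfolding LW T_def g_def b_def h_def by simp
  qed
  have Tc: "T \<in> carrier_mat m m" using E by (auto simp: T_def)
  note wb = woodbury[OF B(1) inv(1) U _ M(1) Cc M(2), of "U\<^sup>T", folded upd H_def, unfolded T]
  have wb1: "invertible_mat (- T)" by (rule wb(1)) (use U inv in auto)
  note nT = mat_inv_props[OF _ wb1, of m]
  have nTc: "- T \<in> carrier_mat m m" using Tc by simp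
  note nT = nT[OF nTc]
  have TT: "T * (- mat_inv (- T)) = 1\<^sub>m m" using nT Tc by simp
  note Ti = inverse_matI[OF Tc _ TT]
  show "invertible_mat T" by (rule Ti) (use nT in simp)
  have Ti': "mat_inv (- T) = - mat_inv T" using Ti(2) nT by simp
  have mTc: "mat_inv T \<in> carrier_mat m m" using Ti(2) nT by simp
  have "mat_inv (broyden_update \<phi> s y B) = H - H * U * mat_inv (- T) * U\<^sup>T * H"
    by (rule wb(2)) (use U inv in auto)
  also have "H * U * mat_inv (- T) * U\<^sup>T * H = - (V * mat_inv T * V\<^sup>T)"
    unfolding HU Ti' using carrier_matD[OF V] carrier_matD[OF mTc] carrier_matD[OF U] carrier_matD[OF H(1)]
    by (simp add: mat_assoc UH)
  also have "H - (- (V * mat_inv T * V\<^sup>T)) = H + V * mat_inv T * V\<^sup>T"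
    using H(1) V by (intro eq_matI) (auto simp del: index_mult_mat(1))
  finally show "mat_inv (broyden_update \<phi> s y B) = H + V * mat_inv T * V\<^sup>T" .
qed

lemma broyden_update_symmetric:
  assumes B: "B \<in> carrier_mat n n" "B\<^sup>T = B" and s: "s \<in> carrier_vec n" and y: "y \<in> carrier_vec n"
  shows "broyden_update \<phi> s y B \<in> carrier_mat n n"
    and "(broyden_update \<phi> s y B)\<^sup>T = broyden_update \<phi> s y B"
proof -
  define w where "w = broyden_w B s y"
  have w: "w \<in> carrier_vec n"
    using carrier_matD[OF B(1)] carrier_vecD[OF s] carrier_vecD[OF y]
    by (intro carrier_vecI) (simp add: w_def broyden_w_def)
  have o: "outer_prod u u \<in> carrier_mat n n" "(outer_prod u u)\<^sup>T = outer_prod u u"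
    if "u \<in> carrier_vec n" for u :: "real vec"
    using that by (auto intro!: eq_matI simp: outer_prod_def)
  define Q where "Q = B * outer_prod s s * B"
  have "Q\<^sup>T = Q" using carrier_matD[OF B(1)] carrier_matD[OF o(1)[OF s]] B(2) o(2)[OF s]
    unfolding Q_def by (simp add: mat_simps)
  moreover have Qc: "Q \<in> carrier_mat n n" unfolding Q_def using B(1) o(1)[OF s] by auto
  ultimately have Q: "Q $$ (j, i) = Q $$ (i, j)" if "i < n" "j < n" for i j
    using that by (metis carrier_matD index_transpose_mat(1))
  have Bs: "B $$ (j, i) = B $$ (i, j)" if "i < n" "j < n" for i j
    using that B by (metis carrier_matD index_transpose_mat(1))
  have os: "outer_prod u u $$ (j, i) = outer_prod u u $$ (i, j)"
    if "i < n" "j < n" "u \<in> carrier_vec n" for i j and u :: "real vec"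
    using that o(2)[of u] o(1)[of u] by (metis carrier_matD index_transpose_mat(1))
  note d = carrier_matD[OF o(1)[OF y]] carrier_matD[OF o(1)[OF w]] carrier_matD[OF Qc]
    carrier_matD[OF B(1)]
  have eq: "broyden_update \<phi> s y B = B - (1 / (s \<bullet> (B *\<^sub>v s))) \<cdot>\<^sub>m Q
       + (1 / (y \<bullet> s)) \<cdot>\<^sub>m outer_prod y y + (\<phi> * (s \<bullet> (B *\<^sub>v s))) \<cdot>\<^sub>m outer_prod w w"
    unfolding broyden_update_def Q_def w_def ..
  show "broyden_update \<phi> s y B \<in> carrier_mat n n"
    unfolding eq using d by (intro carrier_matI) simp_all
  show "(broyden_update \<phi> s y B)\<^sup>T = broyden_update \<phi> s y B"
    unfolding eq using d by (intro eq_matI) (simp_all add: Q Bs os[OF _ _ w] os[OF _ _ y])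
qed

section \<open>The permuted basis and kernel\<close>

text \<open>The column of the entry 1 in row \<open>i\<close> of the permutation matrix.\<close>

definition pi_index :: "nat \<Rightarrow> nat \<Rightarrow> nat" where
  "pi_index k i = (if i < k then i else if i < 2 * k then i + 1 else if i = 2 * k then k else i)"

lemma pi_index_less: "i < 2 * Suc k \<Longrightarrow> pi_index k i < 2 * Suc k"
  by (auto simp: pi_index_def)

lemma Pi_mat_carrier: "Pi_mat k \<in> carrier_mat (2 * Suc k) (2 * Suc k)"
  by (intro carrier_matI) (simp_all add: Pi_mat_def)

lemma Pi_mat_index:
  assumes "i < 2 * Suc k" "j < 2 * Suc k"
  shows "Pi_mat k $$ (i, j) = (if j = pi_index k i then 1 else 0)"
proof -
  have ci: "i < k \<or> (\<exists>i' < k. i = k + i') \<or> i = k + k \<or> i = Suc (k + k)"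
    using assms(1) by (cases "i < k") (auto intro: exI[of _ "i - k"])
  have cj: "j < k \<or> j = k \<or> (\<exists>j' < k. j = Suc k + j') \<or> j = Suc (k + k)"
    using assms(2) by (cases "j \<le> k") (auto intro: exI[of _ "j - Suc k"])
  show ?thesis
    using ci cj by (elim disjE exE conjE) (simp_all add: Pi_mat_def pi_index_def)
qed

lemma mult_transpose_Pi_mat:
  assumes A: "A \<in> carrier_mat n (2 * Suc k)"
  shows "A * (Pi_mat k)\<^sup>T = mat n (2 * Suc k) (\<lambda>(i, j). A $$ (i, pi_index k j))"
proof (rule eq_matI, goal_cases)
  case (1 i j)
  hence ij: "i < n" "j < 2 * Suc k" by auto
  have "(A * (Pi_mat k)\<^sup>T) $$ (i, j) = (\<Sum>l\<in>{0..<2 * Suc k}. A $$ (i, l) * Pi_mat k $$ (j, l))"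
    using ij carrier_matD[OF A] carrier_matD[OF Pi_mat_carrier, of k] by (simp add: scalar_prod_def)
  also have "\<dots> = (\<Sum>l\<in>{0..<2 * Suc k}. if l = pi_index k j then A $$ (i, l) else 0)"
    by (rule sum.cong) (use ij in \<open>auto simp: Pi_mat_index\<close>)
  also have "\<dots> = A $$ (i, pi_index k j)" using pi_index_less[OF ij(2)] by simp
  finally show ?case using ij by simp
qed (use A Pi_mat_carrier[of k] in auto)

lemma Pi_mat_mult:
  assumes A: "A \<in> carrier_mat (2 * Suc k) n"
  shows "Pi_mat k * A = mat (2 * Suc k) n (\<lambda>(i, j). A $$ (pi_index k i, j))"
proof -
  have "(Pi_mat k * A)\<^sup>T = A\<^sup>T * (Pi_mat k)\<^sup>T"
    using A Pi_mat_carrier[of k] by (intro mat_transpose_mult) auto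
  also have "\<dots> = mat n (2 * Suc k) (\<lambda>(i, j). A\<^sup>T $$ (i, pi_index k j))"
    using A by (intro mult_transpose_Pi_mat) auto
  also have "\<dots> = (mat (2 * Suc k) n (\<lambda>(i, j). A $$ (pi_index k i, j)))\<^sup>T"
    using A pi_index_less[of _ k] by (intro eq_matI) auto
  finally show ?thesis by simp
qed

lemma cols_upto_carrier: "cols_upto n k v \<in> carrier_mat n (Suc k)"
  by (intro carrier_matI) (simp_all add: cols_upto_def)

lemma cols_upto_dim [simp]:
  "dim_row (cols_upto n k v) = n" "dim_col (cols_upto n k v) = Suc k"
  using cols_upto_carrier[of n k v] by auto

lemma cols_upto_index: "i < n \<Longrightarrow> j < Suc k \<Longrightarrow> cols_upto n k v $$ (i, j) = v j $ i"
  by (simp add: cols_upto_def mat_of_cols_index del: upt_Suc)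

lemma col_cols_upto: "j < Suc k \<Longrightarrow> v j \<in> carrier_vec n \<Longrightarrow> col (cols_upto n k v) j = v j"
  using cols_upto_carrier[of n k v] by (intro eq_vecI) (auto simp: cols_upto_index)

lemma mult_cols_upto:
  assumes "A \<in> carrier_mat m n" "\<And>j. j \<le> k \<Longrightarrow> v j \<in> carrier_vec n"
  shows "A * cols_upto n k v = cols_upto m k (\<lambda>j. A *\<^sub>v v j)"
  using assms
  by (intro eq_matI) (auto simp: cols_upto_index col_cols_upto)

lemma transpose_cols_upto_mult:
  assumes "\<And>j. j \<le> k \<Longrightarrow> u j \<in> carrier_vec n" "\<And>j. j \<le> k \<Longrightarrow> v j \<in> carrier_vec n"
  shows "(cols_upto n k u)\<^sup>T * cols_upto n k v = mat (Suc k) (Suc k) (\<lambda>(i, j). u i \<bullet> v j)"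
  using assms
  by (intro eq_matI) (auto simp: col_cols_upto)

text \<open>The factor \<open>(S  H Y)\<close> before permutation and compression.\<close>

definition basis_mat :: "nat \<Rightarrow> real mat \<Rightarrow> (nat \<Rightarrow> real vec) \<Rightarrow> (nat \<Rightarrow> real vec) \<Rightarrow> nat \<Rightarrow> real mat" where
  "basis_mat n H s y k = append_cols (cols_upto n k s) (H * cols_upto n k y)"

text \<open>The matrix in the middle of the formula, before permutation and compression; \<open>g j\<close> stands
for \<open>\<gamma>\<^sub>j\<close>.\<close>

definition kernel_mat ::
    "nat \<Rightarrow> real mat \<Rightarrow> (nat \<Rightarrow> real vec) \<Rightarrow> (nat \<Rightarrow> real vec) \<Rightarrow> (nat \<Rightarrow> real) \<Rightarrow> nat \<Rightarrow> real mat" where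
  "kernel_mat n H s y g k =
     (let S = cols_upto n k s; Y = cols_upto n k y; G = mat_diag (Suc k) g;
          D = diag_part (S\<^sup>T * Y); R = strict_upper_part (S\<^sup>T * Y)
      in four_block_mat G (D + R + G) (D + R\<^sup>T + G) (D + G + Y\<^sup>T * H * Y))"

lemma basis_mat_index:
  assumes "H \<in> carrier_mat n n" "\<And>j. j \<le> k \<Longrightarrow> y j \<in> carrier_vec n"
    and "i < n" "j < 2 * Suc k"
  shows "basis_mat n H s y k $$ (i, j) = (if j \<le> k then s j $ i else (H *\<^sub>v y (j - Suc k)) $ i)"
  using assms(3,4)
  unfolding basis_mat_def append_cols_def mult_cols_upto[of H n n k y, OF assms(1,2), simplified]
  by (auto simp: cols_upto_index)

lemma basis_mat_carrier: "H \<in> carrier_mat n n \<Longrightarrow> basis_mat n H s y k \<in> carrier_mat n (2 * Suc k)"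
  by (intro carrier_matI) (auto simp: basis_mat_def append_cols_def)

lemma kernel_mat_carrier: "kernel_mat n H s y g k \<in> carrier_mat (2 * Suc k) (2 * Suc k)"
  by (intro carrier_matI) (auto simp: kernel_mat_def Let_def mat_diag_def)

lemma kernel_mat_index:
  assumes H: "H \<in> carrier_mat n n"
    and s: "\<And>j. j \<le> k \<Longrightarrow> s j \<in> carrier_vec n" and y: "\<And>j. j \<le> k \<Longrightarrow> y j \<in> carrier_vec n"
    and ij: "i \<le> k" "j \<le> k"
  shows "kernel_mat n H s y g k $$ (i, j) = (if i = j then g i else 0)"
    and "kernel_mat n H s y g k $$ (i, Suc k + j) =
      (if i = j then s i \<bullet> y i + g i else if i < j then s i \<bullet> y j else 0)"
    and "kernel_mat n H s y g k $$ (Suc k + i, j) =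
      (if i = j then s i \<bullet> y i + g i else if j < i then s j \<bullet> y i else 0)"
    and "kernel_mat n H s y g k $$ (Suc k + i, Suc k + j) =
      (if i = j then s i \<bullet> y i + g i else 0) + y i \<bullet> (H *\<^sub>v y j)"
proof -
  have SY: "(cols_upto n k s)\<^sup>T * cols_upto n k y = mat (Suc k) (Suc k) (\<lambda>(i, j). s i \<bullet> y j)"
    using s y by (intro transpose_cols_upto_mult) auto
  have "(cols_upto n k y)\<^sup>T * H * cols_upto n k y = (cols_upto n k y)\<^sup>T * (H * cols_upto n k y)"
    using H by (intro mat_assoc) auto
  also have "\<dots> = (cols_upto n k y)\<^sup>T * cols_upto n k (\<lambda>j. H *\<^sub>v y j)"
    by (subst mult_cols_upto[OF H y]) auto
  also have "\<dots> = mat (Suc k) (Suc k) (\<lambda>(i, j). y i \<bullet> (H *\<^sub>v y j))"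
    using y H by (intro transpose_cols_upto_mult) auto
  finally have YHY: "(cols_upto n k y)\<^sup>T * H * cols_upto n k y
      = mat (Suc k) (Suc k) (\<lambda>(i, j). y i \<bullet> (H *\<^sub>v y j))" .
  note eq = kernel_mat_def Let_def SY YHY diag_part_def strict_upper_part_def mat_diag_def
  show "kernel_mat n H s y g k $$ (i, j) = (if i = j then g i else 0)"
    "kernel_mat n H s y g k $$ (i, Suc k + j) =
      (if i = j then s i \<bullet> y i + g i else if i < j then s i \<bullet> y j else 0)"
    "kernel_mat n H s y g k $$ (Suc k + i, j) =
      (if i = j then s i \<bullet> y i + g i else if j < i then s j \<bullet> y i else 0)"
    "kernel_mat n H s y g k $$ (Suc k + i, Suc k + j) =
      (if i = j then s i \<bullet> y i + g i else 0) + y i \<bullet> (H *\<^sub>v y j)"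
    unfolding eq using ij by auto
qed

text \<open>After permutation, adding a pair appends its two columns at the end.\<close>

lemma basis_mat_Pi_Suc:
  assumes H: "H \<in> carrier_mat n n" and s: "\<And>j. j \<le> Suc k \<Longrightarrow> s j \<in> carrier_vec n"
    and y: "\<And>j. j \<le> Suc k \<Longrightarrow> y j \<in> carrier_vec n"
  shows "basis_mat n H s y (Suc k) * (Pi_mat (Suc k))\<^sup>T
    = append_cols (basis_mat n H s y k) (pair_mat (s (Suc k)) (H *\<^sub>v y (Suc k)))"
proof -
  note bc = basis_mat_carrier[OF H, of s y]
  have sn: "dim_vec (s (Suc k)) = n" using s[of "Suc k"] by auto
  show ?thesis unfolding mult_transpose_Pi_mat[OF bc]
  proof (rule eq_matI, goal_cases)
    case (1 i j)
    hence i: "i < n" and j: "j < 2 * k + 4"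
      using carrier_matD[OF bc[of k]] sn by (auto simp: append_cols_def pair_mat_def)
    have ix: "basis_mat n H s y l $$ (i, j) = (if j \<le> l then s j $ i else (H *\<^sub>v y (j - Suc l)) $ i)"
      if "l \<le> Suc k" "j < 2 * Suc l" for l j
      using that y by (intro basis_mat_index[OF H _ i]) auto
    consider "j \<le> k" | "k < j" "j < 2 * k + 2" | "j = 2 * k + 2" | "j = 2 * k + 3" using j by linarith
    thus ?case using i carrier_matD[OF bc[of k]] sn
      by cases (auto simp: ix pi_index_def append_cols_def pair_mat_def)
  qed (use carrier_matD[OF bc[of k]] sn in \<open>auto simp: append_cols_def pair_mat_def\<close>)
qed

text \<open>After permutation, adding a pair borders the kernel. The zero column of \<open>z\<close> reflects that
\<open>R\<close> has no entries \<open>s\<^sub>k\<^sup>T y\<^sub>i\<close> with \<open>i < k\<close>: a new \<open>s\<close> does not interact with earlier pairs.\<close>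

lemma Pi_kernel_mat_Pi_Suc:
  assumes H: "H \<in> carrier_mat n n" and HT: "H\<^sup>T = H"
    and s: "\<And>j. j \<le> Suc k \<Longrightarrow> s j \<in> carrier_vec n"
    and y: "\<And>j. j \<le> Suc k \<Longrightarrow> y j \<in> carrier_vec n"
  defines "P \<equiv> Pi_mat (Suc k)" and "W \<equiv> basis_mat n H s y k" and "z \<equiv> pair_mat (0\<^sub>v n) (y (Suc k))"
  shows "P * kernel_mat n H s y g (Suc k) * P\<^sup>T
    = four_block_mat (kernel_mat n H s y g k) (W\<^sup>T * z) (z\<^sup>T * W)
        (secant_block (g (Suc k)) (y (Suc k) \<bullet> s (Suc k)) (y (Suc k) \<bullet> (H *\<^sub>v y (Suc k))))"
proof -
  note kc = kernel_mat_carrier[of n H s y g]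
  have Wc: "W \<in> carrier_mat n (2 * Suc k)" unfolding W_def by (rule basis_mat_carrier[OF H])
  have zc: "z \<in> carrier_mat n 2" unfolding z_def by (rule pair_mat_carrier) auto
  let ?K = "kernel_mat n H s y g (Suc k)"
  define b where "b = y (Suc k) \<bullet> s (Suc k)"
  have sb: "s (Suc k) \<bullet> y (Suc k) = b"
    unfolding b_def using s y by (intro comm_scalar_prod[of _ n]) auto
  have PK: "P * ?K * P\<^sup>T = mat (2 * Suc (Suc k)) (2 * Suc (Suc k))
      (\<lambda>(i, j). ?K $$ (pi_index (Suc k) i, pi_index (Suc k) j))" (is "_ = ?L")
    unfolding P_def Pi_mat_mult[OF kc]
    by (subst mult_transpose_Pi_mat[of _ "2 * Suc (Suc k)"])
       (auto intro!: eq_matI simp: pi_index_less[of _ "Suc k", simplified])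
  have Wcol: "col W i = (if i \<le> k then s i else H *\<^sub>v y (i - Suc k))" if "i < 2 * Suc k" for i
  proof -
    have "W $$ (j, i) = (if i \<le> k then s i $ j else (H *\<^sub>v y (i - Suc k)) $ j)" if "j < n" for j
      unfolding W_def using \<open>i < 2 * Suc k\<close> that y by (intro basis_mat_index[OF H]) auto
    thus ?thesis using that Wc s[of i] H by (intro eq_vecI) auto
  qed
  have zcol: "col z 0 = 0\<^sub>v n" "col z (Suc 0) = y (Suc k)"
    using y[of "Suc k"] by (auto simp: z_def pair_mat_def)
  have Wz0: "(W\<^sup>T * z) $$ (i, 0) = 0" "(z\<^sup>T * W) $$ (0, i) = 0" if "i < 2 * Suc k" for i
    using that Wc zc zcol by (auto simp: scalar_prod_left_zero scalar_prod_right_zero)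
  have Wz1: "(W\<^sup>T * z) $$ (i, Suc 0) = (if i \<le> k then s i \<bullet> y (Suc k) else y (i - Suc k) \<bullet> (H *\<^sub>v y (Suc k)))"
    and zW1: "(z\<^sup>T * W) $$ (Suc 0, i) = (if i \<le> k then s i \<bullet> y (Suc k) else y (Suc k) \<bullet> (H *\<^sub>v y (i - Suc k)))"
    if i: "i < 2 * Suc k" for i
  proof -
    have "(H *\<^sub>v u) \<bullet> v = u \<bullet> (H *\<^sub>v v)" if "u \<in> carrier_vec n" "v \<in> carrier_vec n" for u v
      using transpose_vec_mult_scalar[OF H that(2,1)] HT by simp
    thus "(W\<^sup>T * z) $$ (i, Suc 0) = (if i \<le> k then s i \<bullet> y (Suc k) else y (i - Suc k) \<bullet> (H *\<^sub>v y (Suc k)))"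
      using i Wc zc zcol Wcol[OF i] y by auto
    have "y (Suc k) \<bullet> s i = s i \<bullet> y (Suc k)" if "i \<le> k"
      using that s y by (intro comm_scalar_prod[of _ n]) auto
    thus "(z\<^sup>T * W) $$ (Suc 0, i) = (if i \<le> k then s i \<bullet> y (Suc k) else y (Suc k) \<bullet> (H *\<^sub>v y (i - Suc k)))"
      using i Wc zc zcol Wcol[OF i] y by auto
  qed
  have pi: "pi_index (Suc k) i = i" "pi_index (Suc k) (Suc k + i) = Suc (Suc k) + i" if "i \<le> k" for i
    using that by (auto simp: pi_index_def)
  have pi': "pi_index (Suc k) (2 * Suc k) = Suc k"
    "pi_index (Suc k) (Suc (2 * Suc k)) = Suc (Suc k) + Suc k" by (auto simp: pi_index_def)
  have Kix: "?K $$ (i, j) = (if i = j then g i else 0)"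
      "?K $$ (i, Suc (Suc k) + j) = (if i = j then s i \<bullet> y i + g i else if i < j then s i \<bullet> y j else 0)"
      "?K $$ (Suc (Suc k) + i, j) = (if i = j then s i \<bullet> y i + g i else if j < i then s j \<bullet> y i else 0)"
      "?K $$ (Suc (Suc k) + i, Suc (Suc k) + j) = (if i = j then s i \<bullet> y i + g i else 0) + y i \<bullet> (H *\<^sub>v y j)"
    if "i \<le> Suc k" "j \<le> Suc k" for i j
    using that s y by (intro kernel_mat_index[OF H]; simp)+
  have kix: "kernel_mat n H s y g k $$ (i, j) = (if i = j then g i else 0)"
      "kernel_mat n H s y g k $$ (i, Suc k + j) = (if i = j then s i \<bullet> y i + g i else if i < j then s i \<bullet> y j else 0)"
      "kernel_mat n H s y g k $$ (Suc k + i, j) = (if i = j then s i \<bullet> y i + g i else if j < i then s j \<bullet> y i else 0)"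
      "kernel_mat n H s y g k $$ (Suc k + i, Suc k + j) = (if i = j then s i \<bullet> y i + g i else 0) + y i \<bullet> (H *\<^sub>v y j)"
    if "i \<le> k" "j \<le> k" for i j
    using that s y by (intro kernel_mat_index[OF H]; simp)+
  define \<sigma> where "\<sigma> = pi_index (Suc k)"
  note pi = pi[folded \<sigma>_def]
  note pi' = pi'[folded \<sigma>_def]
  have split: "i \<le> k \<or> (\<exists>i'. i' \<le> k \<and> i = Suc k + i')" if "i < 2 * Suc k" for i
    using that by (cases "i \<le> k") (auto intro: exI[of _ "i - Suc k"])
  define K K' where "K = kernel_mat n H s y g k" and "K' = ?K"
  note Kix = Kix[folded K'_def]
  note kix = kix[folded K_def]
  \<comment> \<open>The four blocks are compared separately, with an old index \<open>i\<close> split into an \<open>s\<close>-index \<open>i \<le> k\<close> and a \<open>y\<close>-index \<open>Suc k + i'\<close>.\<close>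
  have old: "K' $$ (\<sigma> i, \<sigma> j) = K $$ (i, j)" if "i < 2 * Suc k" "j < 2 * Suc k" for i j
    using split[OF that(1)] split[OF that(2)]
    by (elim disjE exE conjE) (simp_all only: pi Kix kix le_SucI)
  have new: "K' $$ (\<sigma> i, Suc k) = 0" "K' $$ (Suc k, \<sigma> i) = 0"
    "K' $$ (\<sigma> i, Suc (Suc k) + Suc k) = (W\<^sup>T * z) $$ (i, Suc 0)"
    "K' $$ (Suc (Suc k) + Suc k, \<sigma> i) = (z\<^sup>T * W) $$ (Suc 0, i)" if i: "i < 2 * Suc k" for i
  proof -
    from split[OF i] show "K' $$ (\<sigma> i, Suc k) = 0"
      by (elim disjE exE conjE) (simp_all only: pi Kix le_SucI order_refl, simp_all)
    from split[OF i] show "K' $$ (Suc k, \<sigma> i) = 0"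
      by (elim disjE exE conjE) (simp_all only: pi Kix le_SucI order_refl, simp_all)
    from split[OF i] show "K' $$ (\<sigma> i, Suc (Suc k) + Suc k) = (W\<^sup>T * z) $$ (i, Suc 0)"
      unfolding Wz1[OF i]
      by (elim disjE exE conjE) (simp_all only: pi Kix le_SucI order_refl, simp_all)
    from split[OF i] show "K' $$ (Suc (Suc k) + Suc k, \<sigma> i) = (z\<^sup>T * W) $$ (Suc 0, i)"
      unfolding zW1[OF i]
      by (elim disjE exE conjE) (simp_all only: pi Kix le_SucI order_refl, simp_all)
  qed
  have last: "K' $$ (Suc k, Suc k) = g (Suc k)"
    "K' $$ (Suc k, Suc (Suc k) + Suc k) = b + g (Suc k)"
    "K' $$ (Suc (Suc k) + Suc k, Suc k) = b + g (Suc k)"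
    "K' $$ (Suc (Suc k) + Suc k, Suc (Suc k) + Suc k)
      = b + g (Suc k) + y (Suc k) \<bullet> (H *\<^sub>v y (Suc k))"
    by (simp_all only: Kix order_refl sb if_True simp_thms)
  define G where "G = secant_block (g (Suc k)) b (y (Suc k) \<bullet> (H *\<^sub>v y (Suc k)))"
  have G: "G $$ (0, 0) = g (Suc k)" "G $$ (0, Suc 0) = b + g (Suc k)" "G $$ (Suc 0, 0) = b + g (Suc k)"
      "G $$ (Suc 0, Suc 0) = b + g (Suc k) + y (Suc k) \<bullet> (H *\<^sub>v y (Suc k))"
      "dim_row G = 2" "dim_col G = 2"
    by (simp_all add: G_def secant_block_def mat_of_rows_list_def)
  have Kd: "dim_row K = 2 * Suc k" "dim_col K = 2 * Suc k"
    using carrier_matD[OF kc[of k]] by (simp_all add: K_def)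
  define N where "N = 2 * Suc k"
  have fin: "K' $$ (\<sigma> i, \<sigma> j) = four_block_mat K (W\<^sup>T * z) (z\<^sup>T * W) G $$ (i, j)"
    if i: "i < N + 2" and j: "j < N + 2" for i j
  proof -
    note dims = Kd[folded N_def] G(5,6)
    note old = old[folded N_def] and new = new[folded N_def] and W0 = Wz0[folded N_def]
    have \<sigma>N: "\<sigma> N = Suc k" "\<sigma> (Suc N) = Suc (Suc k) + Suc k"
      unfolding N_def by (rule pi')+
    have "i < N \<or> i = N \<or> i = Suc N" "j < N \<or> j = N \<or> j = Suc N" using i j by auto
    thus ?thesis
      by (elim disjE) (simp_all add: dims old new W0 \<sigma>N last G(1-4) del: index_mult_mat(1) add_Suc add_Suc_right)
  qed
  show ?thesis unfolding PK b_def[symmetric] G_def[symmetric] K_def[symmetric]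
  proof (rule eq_matI, goal_cases)
    case (1 i j)
    hence ij: "i < N + 2" "j < N + 2" using Kd G by (simp_all add: N_def)
    show ?case unfolding fin[OF ij, symmetric] K'_def \<sigma>_def
      using ij by (simp add: N_def)
  qed (simp_all add: Kd G)
qed

section \<open>Bordering of the compressed matrices\<close>

lemma E_mat_dim [simp]: "dim_row (E_mat \<phi> s y B) = 2"
  by (simp add: E_mat_def mat_of_cols_list_def)

lemma Pi_mat_dim [simp]: "dim_row (Pi_mat k) = 2 * Suc k" "dim_col (Pi_mat k) = 2 * Suc k"
  using Pi_mat_carrier[of k] by auto

lemma Xi_mat_dim [simp]: "dim_row (Xi_mat B\<^sub>0 s y \<phi> k) = 2 * Suc k"
  by (induction k) (simp_all add: Let_def)

definition middle_mat ::
    "nat \<Rightarrow> real mat \<Rightarrow> (nat \<Rightarrow> real vec) \<Rightarrow> (nat \<Rightarrow> real vec) \<Rightarrow> (nat \<Rightarrow> real) \<Rightarrow> nat \<Rightarrow> real mat" where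
  "middle_mat n B\<^sub>0 s y \<phi> k = - ((Xi_mat B\<^sub>0 s y \<phi> k)\<^sup>T * Pi_mat k
      * kernel_mat n (mat_inv B\<^sub>0) s y (\<lambda>j. gamma (\<phi> j) (s j) (y j) (broyden_seq B\<^sub>0 s y \<phi> j)) k
      * (Pi_mat k)\<^sup>T * Xi_mat B\<^sub>0 s y \<phi> k)"

definition outer_mat ::
    "nat \<Rightarrow> real mat \<Rightarrow> (nat \<Rightarrow> real vec) \<Rightarrow> (nat \<Rightarrow> real vec) \<Rightarrow> (nat \<Rightarrow> real) \<Rightarrow> nat \<Rightarrow> real mat" where
  "outer_mat n B\<^sub>0 s y \<phi> k
    = basis_mat n (mat_inv B\<^sub>0) s y k * ((Pi_mat k)\<^sup>T * Xi_mat B\<^sub>0 s y \<phi> k)"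

context
  fixes n :: nat and B\<^sub>0 :: "real mat" and s y :: "nat \<Rightarrow> real vec" and \<phi> :: "nat \<Rightarrow> real" and H
  assumes H: "H = mat_inv B\<^sub>0" "H \<in> carrier_mat n n" "H\<^sup>T = H"
begin

private abbreviation (input) "B \<equiv> broyden_seq B\<^sub>0 s y \<phi>"
private abbreviation (input) "g \<equiv> (\<lambda>j. gamma (\<phi> j) (s j) (y j) (B j))"

lemma outer_mat_0:
  assumes "s 0 \<in> carrier_vec n" "y 0 \<in> carrier_vec n"
  shows "outer_mat n B\<^sub>0 s y \<phi> 0 = pair_mat (s 0) (H *\<^sub>v y 0) * E_mat (\<phi> 0) (s 0) (y 0) B\<^sub>0"
proof -
  note W = basis_mat_carrier[OF H(2), of s y 0]
  have ix: "basis_mat n H s y 0 $$ (i, j) = (if j \<le> 0 then s 0 $ i else (H *\<^sub>v y (j - 1)) $ i)"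
    if "i < n" "j < 2" for i j
    using basis_mat_index[OF H(2), of 0 y i j s] that assms by simp
  have "basis_mat n H s y 0 = pair_mat (s 0) (H *\<^sub>v y 0)"
    using carrier_matD[OF W] assms
    by (intro eq_matI) (auto simp: ix pair_mat_def less_Suc_eq numeral_2_eq_2)
  thus ?thesis by (simp add: outer_mat_def H(1)[symmetric] Pi_mat_0 left_mult_one_mat'[of _ 2])
qed

lemma middle_mat_0:
  assumes s: "s 0 \<in> carrier_vec n" and y: "y 0 \<in> carrier_vec n"
  defines "E \<equiv> E_mat (\<phi> 0) (s 0) (y 0) B\<^sub>0"
  shows "middle_mat n B\<^sub>0 s y \<phi> 0
    = - (E\<^sup>T * secant_block (g 0) (y 0 \<bullet> s 0) (y 0 \<bullet> (H *\<^sub>v y 0)) * E)"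
proof -
  let ?K = "kernel_mat n H s y g 0"
  have sy: "s 0 \<bullet> y 0 = y 0 \<bullet> s 0" using s y by (rule comm_scalar_prod)
  note ix = kernel_mat_index[OF H(2), of 0 s y 0 0 g, simplified, OF s y]
  have "?K = secant_block (g 0) (y 0 \<bullet> s 0) (y 0 \<bullet> (H *\<^sub>v y 0))"
  proof (rule eq_matI, goal_cases)
    case (1 i j)
    hence "i = 0 \<or> i = Suc 0" "j = 0 \<or> j = Suc 0" by (auto simp: secant_block_def mat_of_rows_list_def)
    thus ?case
      by (elim disjE) (simp_all add: ix[simplified] sy secant_block_def mat_of_rows_list_def)
  qed (use carrier_matD[OF kernel_mat_carrier[of n H s y g 0]] in
        \<open>simp_all add: secant_block_def mat_of_rows_list_def\<close>)
  thus ?thesis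
    by (simp add: middle_mat_def H(1)[symmetric] Pi_mat_0 E_def mat_assoc secant_block_def
        mat_of_rows_list_def left_mult_one_mat'[of _ 2])
qed

text \<open>The recursion of \<open>\<Xi>\<close> compresses the old columns as before and the new pair by its own \<open>E\<close>.\<close>

lemma outer_mat_Suc:
  assumes s: "\<And>j. j \<le> Suc k \<Longrightarrow> s j \<in> carrier_vec n" and y: "\<And>j. j \<le> Suc k \<Longrightarrow> y j \<in> carrier_vec n"
  defines "E \<equiv> E_mat (\<phi> (Suc k)) (s (Suc k)) (y (Suc k)) (B (Suc k))"
  shows "outer_mat n B\<^sub>0 s y \<phi> (Suc k)
    = append_cols (outer_mat n B\<^sub>0 s y \<phi> k) (pair_mat (s (Suc k)) (H *\<^sub>v y (Suc k)) * E)"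
proof -
  define X where "X = (Pi_mat k)\<^sup>T * Xi_mat B\<^sub>0 s y \<phi> k"
  define W where "W = basis_mat n H s y k"
  define v where "v = pair_mat (s (Suc k)) (H *\<^sub>v y (Suc k))"
  have W: "dim_row W = n" "dim_col W = 2 * Suc k"
    using basis_mat_carrier[OF H(2), of s y k] by (auto simp: W_def)
  have v: "v \<in> carrier_mat n 2" unfolding v_def by (rule pair_mat_carrier) (use s in auto)
  have X: "dim_row X = 2 * Suc k" by (simp add: X_def)
  have Edim: "dim_row E = 2" by (simp add: E_def)
  define Z where "Z = four_block_mat X (0\<^sub>m (2 * Suc k) (dim_col E)) (0\<^sub>m 2 (dim_col X)) E"
  have Xi: "Xi_mat B\<^sub>0 s y \<phi> (Suc k) = Z"
    unfolding Xi_mat.simps Let_def X_def[symmetric] E_def[symmetric] Z_def using X Edim by simp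
  have "outer_mat n B\<^sub>0 s y \<phi> (Suc k) = basis_mat n H s y (Suc k) * ((Pi_mat (Suc k))\<^sup>T * Z)"
    unfolding outer_mat_def H(1)[symmetric] Xi ..
  also have "\<dots> = basis_mat n H s y (Suc k) * (Pi_mat (Suc k))\<^sup>T * Z"
    using carrier_matD[OF basis_mat_carrier[OF H(2), of s y "Suc k"]] X Edim
    by (intro mat_assoc[symmetric]) (auto simp: Z_def)
  also have "\<dots> = append_cols W v * Z"
    using basis_mat_Pi_Suc[OF H(2), of k s y] s y by (simp only: W_def v_def)
  also have "\<dots> = append_cols (W * X) (v * E)"
    unfolding append_cols_def Z_def
    by (subst mult_four_block_mat[of _ n "2 * Suc k" _ 2 _ 0 _ _ "dim_col X" _ "dim_col E"])
       (use W X Edim carrier_matD[OF v] in \<open>auto intro!: cong_four_block_mat carrier_matI\<close>)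
  finally show ?thesis unfolding W_def X_def v_def outer_mat_def H(1)[symmetric] .
qed

text \<open>The bordered form needed for \<open>bordered_inverse\<close>: compressing \<open>Pi_kernel_mat_Pi_Suc\<close> by
the block-diagonal \<open>\<Xi>\<close> turns the border \<open>W\<^sup>T z\<close> into \<open>\<Psi>\<^sup>T Z\<close>.\<close>

lemma middle_mat_Suc:
  assumes s: "\<And>j. j \<le> Suc k \<Longrightarrow> s j \<in> carrier_vec n" and y: "\<And>j. j \<le> Suc k \<Longrightarrow> y j \<in> carrier_vec n"
  defines "E \<equiv> E_mat (\<phi> (Suc k)) (s (Suc k)) (y (Suc k)) (B (Suc k))"
  defines "Z \<equiv> pair_mat (0\<^sub>v n) (y (Suc k)) * E" and "\<Psi> \<equiv> outer_mat n B\<^sub>0 s y \<phi> k"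
  shows "middle_mat n B\<^sub>0 s y \<phi> (Suc k)
    = four_block_mat (middle_mat n B\<^sub>0 s y \<phi> k) (- (\<Psi>\<^sup>T * Z)) (- (Z\<^sup>T * \<Psi>))
        (- (E\<^sup>T * secant_block (g (Suc k)) (y (Suc k) \<bullet> s (Suc k)) (y (Suc k) \<bullet> (H *\<^sub>v y (Suc k))) * E))"
proof -
  define X where "X = (Pi_mat k)\<^sup>T * Xi_mat B\<^sub>0 s y \<phi> k"
  define W where "W = basis_mat n H s y k"
  define K where "K = kernel_mat n H s y g k"
  define G where "G = secant_block (g (Suc k)) (y (Suc k) \<bullet> s (Suc k)) (y (Suc k) \<bullet> (H *\<^sub>v y (Suc k)))"
  define z where "z = pair_mat (0\<^sub>v n) (y (Suc k))"
  define r m where "r = dim_col X" and "m = dim_col E"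
  have W: "W \<in> carrier_mat n (2 * Suc k)" using basis_mat_carrier[OF H(2)] by (simp add: W_def)
  have K: "K \<in> carrier_mat (2 * Suc k) (2 * Suc k)" unfolding K_def by (rule kernel_mat_carrier)
  have G: "G \<in> carrier_mat 2 2" unfolding G_def by (rule secant_block_carrier)
  have z: "z \<in> carrier_mat n 2" unfolding z_def by (rule pair_mat_carrier) auto
  have X: "X \<in> carrier_mat (2 * Suc k) r" by (intro carrier_matI) (auto simp: X_def r_def)
  have E: "E \<in> carrier_mat 2 m" by (intro carrier_matI) (auto simp: E_def m_def)
  note d = carrier_matD[OF W] carrier_matD[OF K] carrier_matD[OF G] carrier_matD[OF z]
    carrier_matD[OF X] carrier_matD[OF E]
  define Q where "Q = four_block_mat X (0\<^sub>m (2 * Suc k) m) (0\<^sub>m 2 r) E"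
  have Xi: "Xi_mat B\<^sub>0 s y \<phi> (Suc k) = Q"
    unfolding Xi_mat.simps Let_def X_def[symmetric] E_def[symmetric] Q_def using d by simp
  have QT: "Q\<^sup>T = four_block_mat X\<^sup>T (0\<^sub>m r 2) (0\<^sub>m m (2 * Suc k)) E\<^sup>T"
    unfolding Q_def by (subst transpose_four_block_mat[OF X _ _ E]) auto
  have Qd: "dim_row Q = 2 * Suc (Suc k)" using d by (simp add: Q_def)
  let ?P = "Pi_mat (Suc k)" and ?K' = "kernel_mat n H s y g (Suc k)"
  have K': "dim_row ?K' = 2 * Suc (Suc k)" "dim_col ?K' = 2 * Suc (Suc k)"
    using kernel_mat_carrier[of n H s y g "Suc k"] by auto
  have PK: "?P * ?K' * ?P\<^sup>T = four_block_mat K (W\<^sup>T * z) (z\<^sup>T * W) G"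
    unfolding K_def W_def z_def G_def by (rule Pi_kernel_mat_Pi_Suc[OF H(2,3)]) (use s y in auto)
  have "Q\<^sup>T * ?P * ?K' * ?P\<^sup>T * Q = Q\<^sup>T * (?P * ?K' * ?P\<^sup>T) * Q"
    using Qd K' by (simp add: mat_assoc)
  also have "\<dots> = four_block_mat (X\<^sup>T * K) (X\<^sup>T * (W\<^sup>T * z)) (E\<^sup>T * (z\<^sup>T * W)) (E\<^sup>T * G) * Q"
    unfolding PK QT
    by (subst mult_four_block_mat[of _ r "2 * Suc k" _ 2 _ m _ _ "2 * Suc k" _ 2])
       (use d in \<open>auto intro!: arg_cong[where f = "\<lambda>M. M * Q"] cong_four_block_mat carrier_matI\<close>)
  also have "\<dots> = four_block_mat (X\<^sup>T * K * X) (X\<^sup>T * (W\<^sup>T * z) * E) (E\<^sup>T * (z\<^sup>T * W) * X) (E\<^sup>T * G * E)"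
    unfolding Q_def
    by (subst mult_four_block_mat[of _ r "2 * Suc k" _ 2 _ m _ _ r _ m])
       (use d in \<open>auto intro!: cong_four_block_mat carrier_matI\<close>)
  finally have eq: "Q\<^sup>T * ?P * ?K' * ?P\<^sup>T * Q
      = four_block_mat (X\<^sup>T * K * X) (X\<^sup>T * (W\<^sup>T * z) * E) (E\<^sup>T * (z\<^sup>T * W) * X) (E\<^sup>T * G * E)" .
  have \<Psi>: "\<Psi> = W * X" by (simp add: \<Psi>_def outer_mat_def H(1)[symmetric] W_def X_def)
  have Z: "Z = z * E" by (simp add: Z_def z_def)
  have mid: "middle_mat n B\<^sub>0 s y \<phi> k = - (X\<^sup>T * K * X)"
    using d by (simp add: middle_mat_def H(1)[symmetric] K_def[symmetric] X_def mat_simps)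
  have "middle_mat n B\<^sub>0 s y \<phi> (Suc k)
      = - four_block_mat (X\<^sup>T * K * X) (X\<^sup>T * (W\<^sup>T * z) * E) (E\<^sup>T * (z\<^sup>T * W) * X) (E\<^sup>T * G * E)"
    unfolding middle_mat_def H(1)[symmetric] Xi eq ..
  also have "\<dots> = four_block_mat (- (X\<^sup>T * K * X)) (- (X\<^sup>T * (W\<^sup>T * z) * E))
      (- (E\<^sup>T * (z\<^sup>T * W) * X)) (- (E\<^sup>T * G * E))"
    using d by (intro eq_matI) (auto simp del: index_mult_mat(1))
  also have "X\<^sup>T * (W\<^sup>T * z) * E = \<Psi>\<^sup>T * Z" using d by (simp add: \<Psi> Z mat_simps)
  also have "E\<^sup>T * (z\<^sup>T * W) * X = Z\<^sup>T * \<Psi>" using d by (simp add: \<Psi> Z mat_simps)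
  finally show ?thesis unfolding mid G_def .
qed

end

section \<open>The compact representation of the inverse\<close>

lemma broyden_seq_symmetric:
  assumes "B\<^sub>0 \<in> carrier_mat n n" "B\<^sub>0\<^sup>T = B\<^sub>0"
    and "\<And>i. i < j \<Longrightarrow> s i \<in> carrier_vec n" "\<And>i. i < j \<Longrightarrow> y i \<in> carrier_vec n"
  shows "broyden_seq B\<^sub>0 s y \<phi> j \<in> carrier_mat n n
    \<and> (broyden_seq B\<^sub>0 s y \<phi> j)\<^sup>T = broyden_seq B\<^sub>0 s y \<phi> j"
  using assms by (induction j) (auto intro!: broyden_update_symmetric)

text \<open>Induction on the number of updates. The induction hypothesis expresses the current inverse as
\<open>H = H\<^sub>0 + F\<close>; one update is added by \<open>broyden_update_inverse\<close>, and \<open>bordered_inverse\<close>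
rewrites its correction in terms of \<open>H\<^sub>0\<close>.\<close>

lemma compact_inverse:
  fixes B\<^sub>0 :: "real mat" and s y :: "nat \<Rightarrow> real vec" and \<phi> :: "nat \<Rightarrow> real" and n k :: nat
  assumes B0: "B\<^sub>0 \<in> carrier_mat n n" "B\<^sub>0\<^sup>T = B\<^sub>0"
  defines "B \<equiv> broyden_seq B\<^sub>0 s y \<phi>" and "N \<equiv> middle_mat n B\<^sub>0 s y \<phi>" and "\<Psi> \<equiv> outer_mat n B\<^sub>0 s y \<phi>"
  assumes "\<And>j. j \<le> k \<Longrightarrow> s j \<in> carrier_vec n" "\<And>j. j \<le> k \<Longrightarrow> y j \<in> carrier_vec n"
    and "\<And>j. j \<le> k \<Longrightarrow> y j \<bullet> s j \<noteq> 0" "\<And>j. j \<le> k \<Longrightarrow> s j \<bullet> (B j *\<^sub>v s j) \<noteq> 0"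
    and "\<And>j. j \<le> Suc k \<Longrightarrow> invertible_mat (B j)"
  shows "invertible_mat (N k)
    \<and> mat_inv (B (Suc k)) = mat_inv B\<^sub>0 + \<Psi> k * mat_inv (N k) * (\<Psi> k)\<^sup>T"
  using assms(6-)
proof (induction k)
  case 0
  have B00: "B 0 = B\<^sub>0" and B1: "B (Suc 0) = broyden_update (\<phi> 0) (s 0) (y 0) B\<^sub>0"
    by (simp_all add: B_def)
  have i0: "invertible_mat B\<^sub>0" and i1: "invertible_mat (broyden_update (\<phi> 0) (s 0) (y 0) B\<^sub>0)"
    using 0(5)[of 0] 0(5)[of "Suc 0"] by (simp_all add: B00 B1)
  note H0 = mat_inv_props(1)[OF B0(1) i0] transpose_mat_inv[OF B0(1) i0 B0(2)]
  have s: "s 0 \<in> carrier_vec n" and y: "y 0 \<in> carrier_vec n" using 0(1,2) by auto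
  have a: "s 0 \<bullet> (B\<^sub>0 *\<^sub>v s 0) \<noteq> 0" and b: "y 0 \<bullet> s 0 \<noteq> 0" using 0(3,4)[of 0] by (simp_all add: B00)
  define E where "E = E_mat (\<phi> 0) (s 0) (y 0) B\<^sub>0"
  have "N 0 = - (E\<^sup>T * secant_block (gamma (\<phi> 0) (s 0) (y 0) (broyden_seq B\<^sub>0 s y \<phi> 0)) (y 0 \<bullet> s 0)
      (y 0 \<bullet> (mat_inv B\<^sub>0 *\<^sub>v y 0)) * E)"
    unfolding N_def E_def by (rule middle_mat_0) (use H0 s y in auto)
  moreover have "\<Psi> 0 = pair_mat (s 0) (mat_inv B\<^sub>0 *\<^sub>v y 0) * E"
    unfolding \<Psi>_def E_def by (rule outer_mat_0) (use H0 s y in auto)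
  ultimately show ?case
    using broyden_update_inverse[OF B0 s y a b i0 i1] unfolding B1 E_def by simp
next
  case (Suc k)
  have IH: "invertible_mat (N k)"
      "mat_inv (B (Suc k)) = mat_inv B\<^sub>0 + \<Psi> k * mat_inv (N k) * (\<Psi> k)\<^sup>T"
    using Suc.IH Suc.prems by auto
  define B' H\<^sub>0 H \<sigma> \<eta> where "B' = B (Suc k)" and "H\<^sub>0 = mat_inv B\<^sub>0" and "H = mat_inv B'"
    and "\<sigma> = s (Suc k)" and "\<eta> = y (Suc k)"
  define f where "f = \<phi> (Suc k)"
  have i0: "invertible_mat B\<^sub>0" using Suc.prems(5)[of 0] by (simp add: B_def)
  have B2: "B (Suc (Suc k)) = broyden_update f \<sigma> \<eta> B'" by (simp add: B_def B'_def \<sigma>_def \<eta>_def f_def)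
  have B': "B' \<in> carrier_mat n n" "B'\<^sup>T = B'"
    using broyden_seq_symmetric[OF B0, of "Suc k" s y \<phi>] Suc.prems(1,2) by (auto simp: B'_def B_def)
  have i1: "invertible_mat B'" and i2: "invertible_mat (broyden_update f \<sigma> \<eta> B')"
    using Suc.prems(5)[of "Suc k"] Suc.prems(5)[of "Suc (Suc k)"] by (simp_all add: B2 B'_def)
  note H0 = mat_inv_props(1)[OF B0(1) i0, folded H\<^sub>0_def] transpose_mat_inv[OF B0(1) i0 B0(2), folded H\<^sub>0_def]
  note H = mat_inv_props(1)[OF B'(1) i1, folded H_def] transpose_mat_inv[OF B'(1) i1 B'(2), folded H_def]
  have \<sigma>: "\<sigma> \<in> carrier_vec n" and \<eta>: "\<eta> \<in> carrier_vec n"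
    using Suc.prems(1,2) by (auto simp: \<sigma>_def \<eta>_def)
  have a: "\<sigma> \<bullet> (B' *\<^sub>v \<sigma>) \<noteq> 0" and b: "\<eta> \<bullet> \<sigma> \<noteq> 0"
    using Suc.prems(3,4)[of "Suc k"] by (simp_all add: B'_def \<sigma>_def \<eta>_def)
  define E where "E = E_mat f \<sigma> \<eta> B'"
  define m where "m = dim_col E"
  have E: "E \<in> carrier_mat 2 m" by (intro carrier_matI) (auto simp: E_def m_def)
  define c where "c = gamma f \<sigma> \<eta> B'"
  define b where "b = \<eta> \<bullet> \<sigma>"
  define F where "F = \<Psi> k * mat_inv (N k) * (\<Psi> k)\<^sup>T"
  define z Z V Q where "z = pair_mat (0\<^sub>v n) \<eta>" and "Z = z * E" and "V = pair_mat \<sigma> (H\<^sub>0 *\<^sub>v \<eta>) * E"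
    and "Q = - (E\<^sup>T * secant_block c b (\<eta> \<bullet> (H\<^sub>0 *\<^sub>v \<eta>)) * E)"
  define T where "T = Q - Z\<^sup>T * F * Z"
  define r where "r = dim_col (\<Psi> k)"
  have \<Psi>: "\<Psi> k \<in> carrier_mat n r"
    using basis_mat_carrier[OF H0(1), of s y k]
    by (intro carrier_matI) (auto simp: r_def \<Psi>_def outer_mat_def H\<^sub>0_def)
  have Nc: "N k \<in> carrier_mat r r" by (intro carrier_matI) (simp_all add: N_def middle_mat_def r_def \<Psi>_def outer_mat_def)
  note Ni = mat_inv_props[OF Nc IH(1)]
  have F: "F \<in> carrier_mat n n" unfolding F_def using \<Psi> by (intro carrier_matI) auto
  have HF: "H = H\<^sub>0 + F" using IH(2) by (simp add: H_def B'_def H\<^sub>0_def F_def)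
  have FT: "F\<^sup>T = F"
  proof -
    have "F = H - H\<^sub>0" unfolding HF using F H0(1) by (intro eq_matI) auto
    thus ?thesis using H H0 by (simp add: transpose_minus[of _ n n])
  qed
  have z: "z \<in> carrier_mat n 2" unfolding z_def by (rule pair_mat_carrier) auto
  have Z: "Z \<in> carrier_mat n m" using z E by (auto simp: Z_def)
  have V: "V \<in> carrier_mat n m" 
    unfolding V_def by (rule mult_carrier_mat[OF pair_mat_carrier[OF \<sigma>] E])
  have Q: "Q \<in> carrier_mat m m" using E by (intro carrier_matI) (auto simp: Q_def)
  have F\<eta>: "H *\<^sub>v \<eta> = H\<^sub>0 *\<^sub>v \<eta> + F *\<^sub>v \<eta>" unfolding HF using H0(1) F \<eta> by (rule add_mult_distrib_mat_vec)
  have zFz: "z\<^sup>T * F * z = mat_of_rows_list 2 [[0, 0], [0, \<eta> \<bullet> (F *\<^sub>v \<eta>)]]"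
    unfolding z_def using F \<eta> by (subst quadratic_pair_mat[OF F FT _ \<eta>]) auto
  \<comment> \<open>The Schur complement replaces \<open>y\<^sup>T H\<^sub>0 y\<close> by \<open>y\<^sup>T H y\<close>.\<close>
  have T: "T = - (E\<^sup>T * secant_block c b (\<eta> \<bullet> (H *\<^sub>v \<eta>)) * E)"
  proof -
    define G where "G = secant_block c b (\<eta> \<bullet> (H\<^sub>0 *\<^sub>v \<eta>))"
    have G: "G \<in> carrier_mat 2 2" by (simp add: G_def secant_block_carrier)
    have "\<eta> \<bullet> (H *\<^sub>v \<eta>) = \<eta> \<bullet> (H\<^sub>0 *\<^sub>v \<eta>) + \<eta> \<bullet> (F *\<^sub>v \<eta>)"
      unfolding F\<eta> using \<eta> H0(1) F by (intro scalar_prod_add_distrib) auto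
    hence S: "secant_block c b (\<eta> \<bullet> (H *\<^sub>v \<eta>)) = G + z\<^sup>T * F * z"
      unfolding zFz G_def secant_block_def
      by (intro eq_matI) (auto simp: mat_of_rows_list_def less_Suc_eq numeral_2_eq_2)
    note d = carrier_matD[OF E] carrier_matD[OF F] carrier_matD[OF z] carrier_matD[OF G]
    show ?thesis unfolding S T_def Q_def G_def[symmetric] Z_def
      using d by (intro eq_matI) (simp_all add: mat_simps del: index_mult_mat(1))
  qed
  have VFZ: "V + F * Z = pair_mat \<sigma> (H *\<^sub>v \<eta>) * E"
  proof -
    have "F *\<^sub>v 0\<^sub>v n = 0\<^sub>v n" using F by (intro eq_vecI) auto
    hence "F * z = pair_mat (0\<^sub>v n) (F *\<^sub>v \<eta>)"
      unfolding z_def by (subst mult_pair_mat[OF F _ \<eta>]) auto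
    hence "pair_mat \<sigma> (H\<^sub>0 *\<^sub>v \<eta>) + F * z = pair_mat \<sigma> (H *\<^sub>v \<eta>)"
      unfolding F\<eta> using \<sigma> F H0(1) by (intro eq_matI) (auto simp: pair_mat_def simp del: index_mult_mat_vec)
    moreover have "V + F * Z = (pair_mat \<sigma> (H\<^sub>0 *\<^sub>v \<eta>) + F * z) * E"
      using carrier_matD[OF E] carrier_matD[OF F] carrier_matD[OF z]
        carrier_matD[OF pair_mat_carrier[OF \<sigma>, of "H\<^sub>0 *\<^sub>v \<eta>"]]
      unfolding V_def Z_def by (simp add: mat_simps)
    ultimately show ?thesis by simp
  qed
  note step = broyden_update_inverse[OF B' \<sigma> \<eta> a \<open>\<eta> \<bullet> \<sigma> \<noteq> 0\<close> i1 i2,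
      folded E_def H_def c_def b_def, folded T VFZ]
  have N': "N (Suc k) = four_block_mat (N k) (- ((\<Psi> k)\<^sup>T * Z)) (- (Z\<^sup>T * \<Psi> k)) Q"
    unfolding N_def \<Psi>_def Q_def Z_def z_def E_def c_def b_def f_def \<sigma>_def \<eta>_def B'_def B_def H\<^sub>0_def
    by (rule middle_mat_Suc) (use H0[unfolded H\<^sub>0_def] Suc.prems(1,2) in auto)
  have \<Psi>': "\<Psi> (Suc k) = append_cols (\<Psi> k) V"
    unfolding \<Psi>_def V_def E_def f_def \<sigma>_def \<eta>_def B'_def B_def H\<^sub>0_def
    by (rule outer_mat_Suc) (use H0[unfolded H\<^sub>0_def] Suc.prems(1,2) in auto)
  note bord = bordered_inverse[OF Nc IH(1) \<Psi> Z V Q, folded F_def, folded T_def, folded N' \<Psi>',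
      OF step(1) FT]
  have "mat_inv (B (Suc (Suc k))) = H\<^sub>0 + F + (V + F * Z) * mat_inv T * (V + F * Z)\<^sup>T"
    unfolding B2 step(2) by (simp only: HF)
  also have "\<dots> = H\<^sub>0 + (F + (V + F * Z) * mat_inv T * (V + F * Z)\<^sup>T)"
    using H0(1) F V by (intro assoc_add_mat[of _ n n]) auto
  finally show ?case using bord by (simp add: H\<^sub>0_def)
qed

theorem mainTheorem2:
  fixes n k :: nat
    and B\<^sub>0 :: "real mat"
    and s y :: "nat \<Rightarrow> real vec"
    and \<phi> :: "nat \<Rightarrow> real"
  defines "B \<equiv> broyden_seq B\<^sub>0 s y \<phi>"
  defines "H\<^sub>0 \<equiv> mat_inv B\<^sub>0"
  defines "S \<equiv> cols_upto n k s"
  defines "Y \<equiv> cols_upto n k y"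
  defines "D \<equiv> diag_part (transpose_mat S * Y)"
  defines "R \<equiv> strict_upper_part (transpose_mat S * Y)"
  defines "\<Gamma> \<equiv> Gamma_mat B\<^sub>0 s y \<phi> k"
  defines "P \<equiv> Pi_mat k"
  defines "\<Xi> \<equiv> Xi_mat B\<^sub>0 s y \<phi> k"
  defines "\<Psi> \<equiv> append_cols S (H\<^sub>0 * Y) * (transpose_mat P * \<Xi>)"
  defines "N \<equiv> - (transpose_mat \<Xi> * P
      * four_block_mat \<Gamma> (D + R + \<Gamma>)
          (D + transpose_mat R + \<Gamma>) (D + \<Gamma> + transpose_mat Y * H\<^sub>0 * Y)
      * transpose_mat P * \<Xi>)"
  assumes "B\<^sub>0 \<in> carrier_mat n n"
    and "transpose_mat B\<^sub>0 = B\<^sub>0"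
    and "\<And>j. j \<le> k \<Longrightarrow> s j \<in> carrier_vec n"
    and "\<And>j. j \<le> k \<Longrightarrow> y j \<in> carrier_vec n"
    and "\<And>j. j \<le> k \<Longrightarrow> y j \<bullet> s j \<noteq> 0"
    and "\<And>j. j \<le> k \<Longrightarrow> s j \<bullet> (B j *\<^sub>v s j) \<noteq> 0"
    and "\<And>j. j \<le> Suc k \<Longrightarrow> invertible_mat (B j)"
  shows "invertible_mat N
    \<and> mat_inv (B (Suc k)) = H\<^sub>0 + \<Psi> * mat_inv N * transpose_mat \<Psi>"
proof -
  have "N = middle_mat n B\<^sub>0 s y \<phi> k"
    unfolding N_def middle_mat_def kernel_mat_def Let_def \<Xi>_def P_def \<Gamma>_def Gamma_mat_def
      D_def R_def S_def Y_def H\<^sub>0_def ..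
  moreover have "\<Psi> = outer_mat n B\<^sub>0 s y \<phi> k"
    unfolding \<Psi>_def outer_mat_def basis_mat_def S_def Y_def P_def \<Xi>_def H\<^sub>0_def ..
  ultimately show ?thesis
    using compact_inverse[of B\<^sub>0 n k s y \<phi>] assms(12-) unfolding B_def H\<^sub>0_def by blast
qed

end
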